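(* For an exact Goursat category $\mathcal C$ the following conditions are equivalent: (1) for every object $X$ of $\mathcal C$, the lattice of equivalence relations on $X$ is distributive; (2) for every Birkhoff subcategory $\mathcal L$ of $\mathcal C$, the corresponding closure operator $\overline{(\,\,)}$ on equivalence relations satisfies $$f(\overline{R\wedge S})=\overline{f(R)}\wedge\overline{f(S)}$$ for any regular epimorphism $f\colon X\to Y$ in $\mathcal C$ and any equivalence relations $R$ and $S$ on $X$.
   Context: An exact category is a finitely complete regular category in which every equivalence relation is effective, i.e. is a kernel pair. An exact Goursat category is an exact category in which any two equivalence relations $R,S$ on the same object satisfy $R\circ S\circ R=S\circ R\circ S$, where $\circ$ is relational composition. In such a category the equivalence relations on any object $X$ form a lattice under inclusion of subobjects of $X\times X$ (meet $\wedge$ is intersection, join is $R\vee S=R\circ S\circ R$), and the regular image $f(S)$ of an equivalence relation $S$ on $X$ along a regular epimorphism $f\colon X\to Y$ (the regular image of $S\to X\times X\xrightarrow{f\times f}Y\times Y$) is an equivalence relation on $Y$. An epireflective subcategory $\mathcal L$ of $\mathcal C$ is a full replete reflective subcategory, with inclusion $\iota$ and left adjoint $\lambda$, such that every component $\eta_A\colon A\to\iota\lambda(A)$ of the unit is a regular epimorphism. It is a Birkhoff subcategory if it is closed under regular quotients: if $f\colon X\to Y$ is a regular epimorphism and $X\in\mathcal L$, then $Y\in\mathcal L$. The closure operator corresponding to $\mathcal L$ sends an equivalence relation $S$ on $X$, with quotient $q\colon X\to X/S$ (the coequaliser of the projections of $S$), to the kernel pair $\overline S$ of the composite $\eta_{X/S}\circ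 q\colon X\to\iota\lambda(X/S)$. Equality of relations is equality of subobjects. *)

theory Defs
  imports "HOL-Algebra.Lattice"
begin

section \<open>Categories, functors and adjunctions\<close>

record ('o, 'a) category =
  Obj  :: "'o set"
  Arr  :: "'a set"
  Dom  :: "'a \<Rightarrow> 'o"
  Cod  :: "'a \<Rightarrow> 'o"
  Idt  :: "'o \<Rightarrow> 'a"
  Comp :: "'a \<Rightarrow> 'a \<Rightarrow> 'a"  (infixl "\<cdot>\<index>" 70)

text \<open>\<open>g \<cdot>\<^bsub>C\<^esub> f\<close> is \<open>g\<close> after \<open>f\<close>; it is meaningful only when \<open>Dom C g = Cod C f\<close>.\<close>

definition Hom :: "('o, 'a) category \<Rightarrow> 'o \<Rightarrow> 'o \<Rightarrow> 'a set" where
  "Hom C A B = {f \<in> Arr C. Dom C f = A \<and> Cod C f = B}"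

locale category =
  fixes C :: "('o, 'a) category" (structure)
  assumes dom_obj: "f \<in> Arr C \<Longrightarrow> Dom C f \<in> Obj C"
    and cod_obj: "f \<in> Arr C \<Longrightarrow> Cod C f \<in> Obj C"
    and idt_hom: "A \<in> Obj C \<Longrightarrow> Idt C A \<in> Hom C A A"
    and comp_hom: "\<lbrakk>f \<in> Hom C A B; g \<in> Hom C B D\<rbrakk> \<Longrightarrow> g \<cdot> f \<in> Hom C A D"
    and comp_idt_right: "f \<in> Hom C A B \<Longrightarrow> f \<cdot> Idt C A = f"
    and comp_idt_left: "f \<in> Hom C A B \<Longrightarrow> Idt C B \<cdot> f = f"
    and comp_assoc: "\<lbrakk>f \<in> Hom C A B; g \<in> Hom C B D; h \<in> Hom C D E\<rbrakk>
      \<Longrightarrow> (h \<cdot> g) \<cdot> f = h \<cdot> (g \<cdot> f)"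

locale cat_functor = J: category J + C: category C
  for J :: "('p, 'b) category" and C :: "('o, 'a) category" +
  fixes Fo :: "'p \<Rightarrow> 'o" and Fa :: "'b \<Rightarrow> 'a"
  assumes map_obj: "A \<in> Obj J \<Longrightarrow> Fo A \<in> Obj C"
    and map_hom: "u \<in> Hom J A B \<Longrightarrow> Fa u \<in> Hom C (Fo A) (Fo B)"
    and map_idt: "A \<in> Obj J \<Longrightarrow> Fa (Idt J A) = Idt C (Fo A)"
    and map_comp: "\<lbrakk>u \<in> Hom J A B; v \<in> Hom J B D\<rbrakk>
      \<Longrightarrow> Fa (v \<cdot>\<^bsub>J\<^esub> u) = Fa v \<cdot>\<^bsub>C\<^esub> Fa u"

text \<open>\<open>F = (Fo, Fa)\<close> from \<open>C\<close> to \<open>D\<close> is left adjoint to \<open>G = (Go, Ga)\<close> with unit \<open>\<eta>\<close>.\<close>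

locale adjunction = F: cat_functor C D Fo Fa + G: cat_functor D C Go Ga
  for C :: "('o, 'a) category" and D :: "('p, 'b) category"
    and Fo Fa Go Ga +
  fixes \<eta> :: "'o \<Rightarrow> 'a"
  assumes unit_hom: "A \<in> Obj C \<Longrightarrow> \<eta> A \<in> Hom C A (Go (Fo A))"
    and unit_natural: "f \<in> Hom C A B \<Longrightarrow> \<eta> B \<cdot>\<^bsub>C\<^esub> f = Ga (Fa f) \<cdot>\<^bsub>C\<^esub> \<eta> A"
    and unit_universal: "\<lbrakk>A \<in> Obj C; Y \<in> Obj D; h \<in> Hom C A (Go Y)\<rbrakk>
      \<Longrightarrow> \<exists>!g. g \<in> Hom D (Fo A) Y \<and> Ga g \<cdot>\<^bsub>C\<^esub> \<eta> A = h"

definition isomorphism :: "('o, 'a) category \<Rightarrow> 'a \<Rightarrow> bool" where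
  "isomorphism C f \<longleftrightarrow> f \<in> Arr C \<and> (\<exists>g \<in> Hom C (Cod C f) (Dom C f).
     g \<cdot>\<^bsub>C\<^esub> f = Idt C (Dom C f) \<and> f \<cdot>\<^bsub>C\<^esub> g = Idt C (Cod C f))"

definition monomorphism :: "('o, 'a) category \<Rightarrow> 'a \<Rightarrow> bool" where
  "monomorphism C m \<longleftrightarrow> m \<in> Arr C \<and>
     (\<forall>T. \<forall>f \<in> Hom C T (Dom C m). \<forall>g \<in> Hom C T (Dom C m).
        m \<cdot>\<^bsub>C\<^esub> f = m \<cdot>\<^bsub>C\<^esub> g \<longrightarrow> f = g)"


section \<open>Finite limits, coequalisers, regular categories\<close>

definition is_cone ::
  "('p, 'b) category \<Rightarrow> ('o, 'a) category \<Rightarrow> ('p \<Rightarrow> 'o) \<Rightarrow> ('b \<Rightarrow> 'a) \<Rightarrow> 'o \<Rightarrow> ('p \<Rightarrow> 'a) \<Rightarrow> bool" where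
  "is_cone J C Fo Fa L c \<longleftrightarrow> L \<in> Obj C \<and>
     (\<forall>j \<in> Obj J. c j \<in> Hom C L (Fo j)) \<and>
     (\<forall>u \<in> Arr J. Fa u \<cdot>\<^bsub>C\<^esub> c (Dom J u) = c (Cod J u))"

definition is_limit ::
  "('p, 'b) category \<Rightarrow> ('o, 'a) category \<Rightarrow> ('p \<Rightarrow> 'o) \<Rightarrow> ('b \<Rightarrow> 'a) \<Rightarrow> 'o \<Rightarrow> ('p \<Rightarrow> 'a) \<Rightarrow> bool" where
  "is_limit J C Fo Fa L c \<longleftrightarrow> is_cone J C Fo Fa L c \<and>
     (\<forall>B b. is_cone J C Fo Fa B b \<longrightarrow>
        (\<exists>!h. h \<in> Hom C B L \<and> (\<forall>j \<in> Obj J. c j \<cdot>\<^bsub>C\<^esub> h = b j)))"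

text \<open>Every finite category is isomorphic to one whose objects and arrows are natural numbers,
  so it is enough to let \<open>J\<close> range over those.\<close>

locale finitely_complete_category = category +
  assumes finite_limits:
    "\<lbrakk>finite (Obj J); finite (Arr J); cat_functor (J :: (nat, nat) category) C Fo Fa\<rbrakk>
      \<Longrightarrow> \<exists>L c. is_limit J C Fo Fa L c"

definition is_product ::
  "('o, 'a) category \<Rightarrow> 'o \<Rightarrow> 'o \<Rightarrow> 'o \<Rightarrow> 'a \<Rightarrow> 'a \<Rightarrow> bool" where
  "is_product C A B P p q \<longleftrightarrow> P \<in> Obj C \<and> p \<in> Hom C P A \<and> q \<in> Hom C P B \<and>
     (\<forall>T. \<forall>f \<in> Hom C T A. \<forall>g \<in> Hom C T B.
        \<exists>!h. h \<in> Hom C T P \<and> p \<cdot>\<^bsub>C\<^esub> h = f \<and> q \<cdot>\<^bsub>C\<^esub> h = g)"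

definition is_pullback ::
  "('o, 'a) category \<Rightarrow> 'a \<Rightarrow> 'a \<Rightarrow> 'o \<Rightarrow> 'a \<Rightarrow> 'a \<Rightarrow> bool" where
  "is_pullback C f g P p q \<longleftrightarrow> f \<in> Arr C \<and> g \<in> Arr C \<and> Cod C f = Cod C g \<and>
     P \<in> Obj C \<and> p \<in> Hom C P (Dom C f) \<and> q \<in> Hom C P (Dom C g) \<and>
     f \<cdot>\<^bsub>C\<^esub> p = g \<cdot>\<^bsub>C\<^esub> q \<and>
     (\<forall>T. \<forall>u \<in> Hom C T (Dom C f). \<forall>v \<in> Hom C T (Dom C g). f \<cdot>\<^bsub>C\<^esub> u = g \<cdot>\<^bsub>C\<^esub> v \<longrightarrow>
        (\<exists>!h. h \<in> Hom C T P \<and> p \<cdot>\<^bsub>C\<^esub> h = u \<and> q \<cdot>\<^bsub>C\<^esub> h = v))"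

definition is_coequaliser :: "('o, 'a) category \<Rightarrow> 'a \<Rightarrow> 'a \<Rightarrow> 'a \<Rightarrow> bool" where
  "is_coequaliser C f g q \<longleftrightarrow> f \<in> Arr C \<and> g \<in> Hom C (Dom C f) (Cod C f) \<and>
     q \<in> Arr C \<and> Dom C q = Cod C f \<and> q \<cdot>\<^bsub>C\<^esub> f = q \<cdot>\<^bsub>C\<^esub> g \<and>
     (\<forall>T. \<forall>k \<in> Hom C (Cod C f) T. k \<cdot>\<^bsub>C\<^esub> f = k \<cdot>\<^bsub>C\<^esub> g \<longrightarrow>
        (\<exists>!h. h \<in> Hom C (Cod C q) T \<and> h \<cdot>\<^bsub>C\<^esub> q = k))"

definition regular_epi :: "('o, 'a) category \<Rightarrow> 'a \<Rightarrow> bool" where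
  "regular_epi C q \<longleftrightarrow> (\<exists>f g. is_coequaliser C f g q)"

locale regular_category = finitely_complete_category +
  assumes kernel_pair_coequaliser: "is_pullback C f f P p q \<Longrightarrow> \<exists>e. is_coequaliser C p q e"
    and regular_epi_stable: "\<lbrakk>is_pullback C f g P p q; regular_epi C g\<rbrakk> \<Longrightarrow> regular_epi C p"


section \<open>Relations as subobjects of a product\<close>

text \<open>Products, images, composites, quotients and kernel relations below are chosen
  representatives; in a regular (resp. exact) category they exist and are unique up to isomorphism,
  and the relations among them are unique as subobjects.\<close>

definition chosen_product :: "('o, 'a) category \<Rightarrow> 'o \<Rightarrow> 'o \<Rightarrow> 'o \<times> 'a \<times> 'a" where
  "chosen_product C A B = (SOME (P, p, q). is_product C A B P p q)"

definition prd :: "('o, 'a) category \<Rightarrow> 'o \<Rightarrow> 'o \<Rightarrow> 'o" where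
  "prd C A B = fst (chosen_product C A B)"

definition prj1 :: "('o, 'a) category \<Rightarrow> 'o \<Rightarrow> 'o \<Rightarrow> 'a" where
  "prj1 C A B = fst (snd (chosen_product C A B))"

definition prj2 :: "('o, 'a) category \<Rightarrow> 'o \<Rightarrow> 'o \<Rightarrow> 'a" where
  "prj2 C A B = snd (snd (chosen_product C A B))"

definition tuple :: "('o, 'a) category \<Rightarrow> 'a \<Rightarrow> 'a \<Rightarrow> 'a" where
  "tuple C f g = (THE h. h \<in> Hom C (Dom C f) (prd C (Cod C f) (Cod C g)) \<and>
     prj1 C (Cod C f) (Cod C g) \<cdot>\<^bsub>C\<^esub> h = f \<and> prj2 C (Cod C f) (Cod C g) \<cdot>\<^bsub>C\<^esub> h = g)"

definition prod_map :: "('o, 'a) category \<Rightarrow> 'a \<Rightarrow> 'a \<Rightarrow> 'a" where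
  "prod_map C f g =
     tuple C (f \<cdot>\<^bsub>C\<^esub> prj1 C (Dom C f) (Dom C g)) (g \<cdot>\<^bsub>C\<^esub> prj2 C (Dom C f) (Dom C g))"

text \<open>Monomorphisms with the same codomain are compared by factorisation; two of them are
  equal as subobjects if each factors through the other.\<close>

definition subobj_le :: "('o, 'a) category \<Rightarrow> 'a \<Rightarrow> 'a \<Rightarrow> bool" where
  "subobj_le C r s \<longleftrightarrow> (\<exists>h \<in> Hom C (Dom C r) (Dom C s). s \<cdot>\<^bsub>C\<^esub> h = r)"

definition subobj_eq :: "('o, 'a) category \<Rightarrow> 'a \<Rightarrow> 'a \<Rightarrow> bool" where
  "subobj_eq C r s \<longleftrightarrow> subobj_le C r s \<and> subobj_le C s r"

definition regular_image :: "('o, 'a) category \<Rightarrow> 'a \<Rightarrow> 'a" where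
  "regular_image C f = (SOME m. monomorphism C m \<and>
     (\<exists>e. regular_epi C e \<and> e \<in> Hom C (Dom C f) (Dom C m) \<and> m \<cdot>\<^bsub>C\<^esub> e = f))"

definition relation_on :: "('o, 'a) category \<Rightarrow> 'o \<Rightarrow> 'a \<Rightarrow> bool" where
  "relation_on C X R \<longleftrightarrow> X \<in> Obj C \<and> monomorphism C R \<and> Cod C R = prd C X X"

definition leg1 :: "('o, 'a) category \<Rightarrow> 'o \<Rightarrow> 'a \<Rightarrow> 'a" where
  "leg1 C X R = prj1 C X X \<cdot>\<^bsub>C\<^esub> R"

definition leg2 :: "('o, 'a) category \<Rightarrow> 'o \<Rightarrow> 'a \<Rightarrow> 'a" where
  "leg2 C X R = prj2 C X X \<cdot>\<^bsub>C\<^esub> R"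

definition equivalence_relation :: "('o, 'a) category \<Rightarrow> 'o \<Rightarrow> 'a \<Rightarrow> bool" where
  "equivalence_relation C X R \<longleftrightarrow> relation_on C X R \<and>
     (\<exists>d \<in> Hom C X (Dom C R). leg1 C X R \<cdot>\<^bsub>C\<^esub> d = Idt C X \<and> leg2 C X R \<cdot>\<^bsub>C\<^esub> d = Idt C X) \<and>
     (\<exists>s \<in> Hom C (Dom C R) (Dom C R).
        leg1 C X R \<cdot>\<^bsub>C\<^esub> s = leg2 C X R \<and> leg2 C X R \<cdot>\<^bsub>C\<^esub> s = leg1 C X R) \<and>
     (\<forall>P u v. is_pullback C (leg2 C X R) (leg1 C X R) P u v \<longrightarrow>
        (\<exists>t \<in> Hom C P (Dom C R).
           leg1 C X R \<cdot>\<^bsub>C\<^esub> t = leg1 C X R \<cdot>\<^bsub>C\<^esub> u \<and> leg2 C X R \<cdot>\<^bsub>C\<^esub> t = leg2 C X R \<cdot>\<^bsub>C\<^esub> v))"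

text \<open>\<open>rel_comp C X R S\<close> is \<open>R \<circ> S\<close> with \<open>S\<close> applied first. The opposite convention would
  not change the threefold composites \<open>R \<circ> S \<circ> R\<close>.\<close>

definition rel_comp :: "('o, 'a) category \<Rightarrow> 'o \<Rightarrow> 'a \<Rightarrow> 'a \<Rightarrow> 'a" where
  "rel_comp C X R S =
     (let (P, u, v) = (SOME (P, u, v). is_pullback C (leg2 C X S) (leg1 C X R) P u v)
      in regular_image C (tuple C (leg1 C X S \<cdot>\<^bsub>C\<^esub> u) (leg2 C X R \<cdot>\<^bsub>C\<^esub> v)))"

definition rel_image :: "('o, 'a) category \<Rightarrow> 'a \<Rightarrow> 'a \<Rightarrow> 'a" where
  "rel_image C f S = regular_image C (prod_map C f f \<cdot>\<^bsub>C\<^esub> S)"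

definition is_kernel_relation :: "('o, 'a) category \<Rightarrow> 'a \<Rightarrow> 'a \<Rightarrow> bool" where
  "is_kernel_relation C g R \<longleftrightarrow> relation_on C (Dom C g) R \<and>
     is_pullback C g g (Dom C R) (leg1 C (Dom C g) R) (leg2 C (Dom C g) R)"

definition kernel_relation :: "('o, 'a) category \<Rightarrow> 'a \<Rightarrow> 'a" where
  "kernel_relation C g = (SOME R. is_kernel_relation C g R)"

definition quotient_map :: "('o, 'a) category \<Rightarrow> 'o \<Rightarrow> 'a \<Rightarrow> 'a" where
  "quotient_map C X S = (SOME q. is_coequaliser C (leg1 C X S) (leg2 C X S) q)"


section \<open>Exact Goursat categories and lattices of equivalence relations\<close>

locale exact_category = regular_category +
  assumes effective: "equivalence_relation C X R
    \<Longrightarrow> \<exists>g. g \<in> Arr C \<and> Dom C g = X \<and> is_kernel_relation C g R"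

locale exact_goursat_category = exact_category +
  assumes goursat: "\<lbrakk>equivalence_relation C X R; equivalence_relation C X S\<rbrakk>
    \<Longrightarrow> subobj_eq C (rel_comp C X (rel_comp C X R S) R) (rel_comp C X (rel_comp C X S R) S)"

text \<open>Elements are monomorphisms; the equality of the ordered structure is equality of
  subobjects, so that this is a weak lattice in the sense of the library.\<close>

definition eqrel_lattice :: "('o, 'a) category \<Rightarrow> 'o \<Rightarrow> 'a gorder" where
  "eqrel_lattice C X =
     \<lparr>carrier = {R. equivalence_relation C X R}, eq = subobj_eq C, le = subobj_le C\<rparr>"

locale weak_distributive_lattice = weak_lattice +
  assumes meet_join_distrib: "\<lbrakk>x \<in> carrier L; y \<in> carrier L; z \<in> carrier L\<rbrakk>
    \<Longrightarrow> x \<sqinter> (y \<squnion> z) .= (x \<sqinter> y) \<squnion> (x \<sqinter> z)"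


section \<open>Birkhoff subcategories and their closure operators\<close>

text \<open>A full subcategory is given by its set \<open>L\<close> of objects.\<close>

definition full_subcategory :: "('o, 'a) category \<Rightarrow> 'o set \<Rightarrow> ('o, 'a) category" where
  "full_subcategory C L = C\<lparr>Obj := L, Arr := {f \<in> Arr C. Dom C f \<in> L \<and> Cod C f \<in> L}\<rparr>"

text \<open>The reflector is \<open>Lo\<close> on objects and \<open>La\<close> on arrows; the inclusion acts as the
  identity on objects and arrows.\<close>

locale epireflective_subcategory = category C
  for C :: "('o, 'a) category" (structure) +
  fixes L :: "'o set" and Lo :: "'o \<Rightarrow> 'o" and La :: "'a \<Rightarrow> 'a" and \<eta> :: "'o \<Rightarrow> 'a"
  assumes sub_obj: "L \<subseteq> Obj C"
    and replete: "\<lbrakk>isomorphism C f; Dom C f \<in> L\<rbrakk> \<Longrightarrow> Cod C f \<in> L"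
    and reflective: "adjunction C (full_subcategory C L) Lo La (\<lambda>A. A) (\<lambda>f. f) \<eta>"
    and unit_regular_epi: "A \<in> Obj C \<Longrightarrow> regular_epi C (\<eta> A)"

locale birkhoff_subcategory = epireflective_subcategory +
  assumes quotient_closed: "\<lbrakk>regular_epi C f; Dom C f \<in> L\<rbrakk> \<Longrightarrow> Cod C f \<in> L"

definition eqrel_closure :: "('o, 'a) category \<Rightarrow> ('o \<Rightarrow> 'a) \<Rightarrow> 'o \<Rightarrow> 'a \<Rightarrow> 'a" where
  "eqrel_closure C \<eta> X S =
     kernel_relation C (\<eta> (Cod C (quotient_map C X S)) \<cdot>\<^bsub>C\<^esub> quotient_map C X S)"

end

theory Submission
  imports Defs
begin

text \<open>Both conditions say that joining with a fixed equivalence relation preserves binary meets.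

  Let \<open>f\<close> be a regular epimorphism with kernel pair \<open>K\<close>. In an exact Goursat category \<open>f(S)\<close> is an
  equivalence relation, and its inverse image along \<open>f\<close> is \<open>K \<or> S\<close> (\<open>gpairs_image_iff_join\<close>).
  So equations between relations on the codomain of \<open>f\<close> become equations between joins on its
  domain.

  Suppose \<open>\<eta>\<close> is the unit of a Birkhoff subcategory and \<open>N\<close> is the kernel pair of \<open>\<eta>\<^sub>X\<close>. Closure under
  regular quotients forces the kernel pair of \<open>\<eta>\<^sub>Z\<close> to be the image of \<open>N\<close> along every regular
  epimorphism \<open>X \<rightarrow> Z\<close> (\<open>birkhoff_unit_kernel_image\<close>). Applied to the quotient by \<open>S\<close> this says that
  the closure of \<open>S\<close> is \<open>S \<or> N\<close>, and applied to the quotient of \<open>Y\<close> by \<open>f(S)\<close> that the inverse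
  image along \<open>f\<close> of the closure of \<open>f(S)\<close> is \<open>(K \<or> S) \<or> N\<close>. The equation for \<open>f\<close>, \<open>R\<close> and \<open>S\<close>
  pulls back to
  \<open>K \<or> ((R \<and> S) \<or> N) = ((K \<or> R) \<or> N) \<and> ((K \<or> S) \<or> N)\<close>,
  an instance of the distributive law.

  Conversely, the whole category is a Birkhoff subcategory, with trivial closure operator. The
  equation for it and for the quotient \<open>f\<close> by an equivalence relation \<open>T\<close> pulls back to
  \<open>T \<or> (R \<and> S) = (T \<or> R) \<and> (T \<or> S)\<close>, which is distributivity in its dual form
  (\<open>weak_distributive_lattice_iff\<close>).

  The calculations with relations use generalized elements: a relation on \<open>X\<close> is determined by
  the parallel pairs of arrows into \<open>X\<close> that factor through it (\<open>gpairs\<close>). Inclusion, intersection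
  and kernel pairs then mean what they mean for sets. Images and composites involve an existential
  quantifier, which is witnessed after precomposition with a regular epimorphism, a cover.
  Such covers are harmless because membership descends along them (\<open>gpairs_local\<close>).\<close>

section \<open>Arrows and strong epimorphisms\<close>

context category
begin

lemma HomD:
  assumes "f \<in> Hom C A B"
  shows "f \<in> Arr C" "Dom C f = A" "Cod C f = B" "A \<in> Obj C" "B \<in> Obj C"
  using assms dom_obj cod_obj by (auto simp: Hom_def)

lemma arr_hom: "f \<in> Arr C \<Longrightarrow> f \<in> Hom C (Dom C f) (Cod C f)"
  by (simp add: Hom_def)

lemma comp_ends:
  assumes "f \<in> Arr C" "g \<in> Arr C" "Cod C f = Dom C g"
  shows "g \<cdot> f \<in> Arr C" "Dom C (g \<cdot> f) = Dom C f" "Cod C (g \<cdot> f) = Cod C g"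
  using comp_hom[of f "Dom C f" "Cod C f" g "Cod C g"] assms by (auto simp: Hom_def)

lemma monomorphism_cancel:
  "\<lbrakk>monomorphism C m; m \<in> Hom C A B; f \<in> Hom C T A; g \<in> Hom C T A; m \<cdot> f = m \<cdot> g\<rbrakk> \<Longrightarrow> f = g"
  unfolding monomorphism_def by (auto dest: HomD)

lemma coequaliser_factor:
  assumes "is_coequaliser C f g q" "q \<in> Hom C A B" "k \<in> Hom C A T" "k \<cdot> f = k \<cdot> g"
  shows "\<exists>!h. h \<in> Hom C B T \<and> h \<cdot> q = k"
proof -
  have "Cod C f = A" "Cod C q = B" using assms(1,2) unfolding is_coequaliser_def by (auto dest: HomD)
  then show ?thesis using assms unfolding is_coequaliser_def by blast
qed

lemma coequaliser_homs:
  assumes "is_coequaliser C f g q"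
  obtains P A B where "f \<in> Hom C P A" "g \<in> Hom C P A" "q \<in> Hom C A B" "q \<cdot> f = q \<cdot> g"
  using assms that[of "Dom C f" "Cod C f" "Cod C q"] unfolding is_coequaliser_def by (auto simp: Hom_def)

lemma regular_epi_arr: "regular_epi C e \<Longrightarrow> e \<in> Arr C"
  unfolding regular_epi_def is_coequaliser_def by blast

lemma regular_epi_cancel:
  assumes e: "regular_epi C e" "e \<in> Hom C U T"
    and xy: "x \<in> Hom C T X" "y \<in> Hom C T X" "x \<cdot> e = y \<cdot> e"
  shows "x = y"
proof -
  obtain f g where q: "is_coequaliser C f g e" using e by (auto simp: regular_epi_def)
  obtain P where fg: "f \<in> Hom C P U" "g \<in> Hom C P U" "e \<cdot> f = e \<cdot> g"
    using coequaliser_homs[OF q] e(2) by (metis HomD(2))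
  have "(x \<cdot> e) \<cdot> f = (x \<cdot> e) \<cdot> g"
    using comp_assoc[OF fg(1) e(2) xy(1)] comp_assoc[OF fg(2) e(2) xy(1)] fg(3) by simp
  then show ?thesis
    using coequaliser_factor[OF q e(2) comp_hom[OF e(2) xy(1)]] xy by metis
qed

text \<open>Left orthogonality to monomorphisms is closed under composition and passes to right factors by
  formal arguments. Regular epimorphisms inherit both properties once the two notions are seen to
  coincide, which needs factorisations.\<close>

definition strong_epi :: "'a \<Rightarrow> bool" where
  "strong_epi e \<longleftrightarrow> e \<in> Arr C \<and>
     (\<forall>m u v. monomorphism C m \<and> u \<in> Hom C (Dom C e) (Dom C m) \<and> v \<in> Hom C (Cod C e) (Cod C m) \<and>
        m \<cdot> u = v \<cdot> e \<longrightarrow> (\<exists>d \<in> Hom C (Cod C e) (Dom C m). m \<cdot> d = v))"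

lemma strong_epi_lift:
  assumes "strong_epi e" "e \<in> Hom C U T" "monomorphism C m" "m \<in> Hom C A B"
    "u \<in> Hom C U A" "v \<in> Hom C T B" "m \<cdot> u = v \<cdot> e"
  shows "\<exists>d \<in> Hom C T A. m \<cdot> d = v"
  using assms unfolding strong_epi_def by (metis HomD(2) HomD(3))

lemma regular_epi_strong:
  assumes e: "regular_epi C e"
  shows "strong_epi e"
  unfolding strong_epi_def
proof (intro conjI allI impI)
  show "e \<in> Arr C" using e by (rule regular_epi_arr)
  fix m u v
  assume A: "monomorphism C m \<and> u \<in> Hom C (Dom C e) (Dom C m) \<and> v \<in> Hom C (Cod C e) (Cod C m) \<and>
        m \<cdot> u = v \<cdot> e"
  have m: "m \<in> Hom C (Dom C m) (Cod C m)" using A by (auto simp: monomorphism_def Hom_def)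
  have eh: "e \<in> Hom C (Dom C e) (Cod C e)" using regular_epi_arr[OF e] by (rule arr_hom)
  obtain f g where q: "is_coequaliser C f g e" using e by (auto simp: regular_epi_def)
  obtain P where fg: "f \<in> Hom C P (Dom C e)" "g \<in> Hom C P (Dom C e)" "e \<cdot> f = e \<cdot> g"
    using coequaliser_homs[OF q] by (metis HomD(2))
  have u: "u \<in> Hom C (Dom C e) (Dom C m)" and v: "v \<in> Hom C (Cod C e) (Cod C m)"
    and mu: "m \<cdot> u = v \<cdot> e" using A by auto
  have "m \<cdot> (u \<cdot> f) = m \<cdot> (u \<cdot> g)"
    using comp_assoc[OF fg(1) u m] comp_assoc[OF fg(2) u m] comp_assoc[OF fg(1) eh v]
      comp_assoc[OF fg(2) eh v] fg(3) mu by simp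
  then have "u \<cdot> f = u \<cdot> g"
    using monomorphism_cancel[of m] A m comp_hom[OF fg(1) u] comp_hom[OF fg(2) u] by blast
  then obtain d where d: "d \<in> Hom C (Cod C e) (Dom C m)" "d \<cdot> e = u"
    using coequaliser_factor[OF q eh u] by blast
  have "(m \<cdot> d) \<cdot> e = v \<cdot> e" using comp_assoc[OF eh d(1) m] d mu by simp
  then have "m \<cdot> d = v" using regular_epi_cancel[OF e eh comp_hom[OF d(1) m] v] by blast
  then show "\<exists>d \<in> Hom C (Cod C e) (Dom C m). m \<cdot> d = v" using d by blast
qed

lemma strong_epi_comp:
  assumes e: "strong_epi e" "e \<in> Hom C A B" and k: "strong_epi k" "k \<in> Hom C B D"
  shows "strong_epi (k \<cdot> e)"
  unfolding strong_epi_def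
proof (intro conjI allI impI)
  have ke: "k \<cdot> e \<in> Hom C A D" using e k comp_hom by blast
  then show "k \<cdot> e \<in> Arr C" by (rule HomD)
  fix m u v
  assume A: "monomorphism C m \<and> u \<in> Hom C (Dom C (k \<cdot> e)) (Dom C m) \<and>
    v \<in> Hom C (Cod C (k \<cdot> e)) (Cod C m) \<and> m \<cdot> u = v \<cdot> (k \<cdot> e)"
  have m: "m \<in> Hom C (Dom C m) (Cod C m)" using A by (auto simp: monomorphism_def Hom_def)
  have u: "u \<in> Hom C A (Dom C m)" and v: "v \<in> Hom C D (Cod C m)" using A HomD[OF ke] by auto
  have "m \<cdot> u = (v \<cdot> k) \<cdot> e" using A comp_assoc[OF e(2) k(2) v] by simp
  then obtain d where d: "d \<in> Hom C B (Dom C m)" "m \<cdot> d = v \<cdot> k"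
    using strong_epi_lift[OF e _ m u comp_hom[OF k(2) v]] A by blast
  then show "\<exists>d \<in> Hom C (Cod C (k \<cdot> e)) (Dom C m). m \<cdot> d = v"
    using strong_epi_lift[OF k _ m d(1) v] A HomD[OF ke] by auto
qed

lemma strong_epi_right_factor:
  assumes ke: "strong_epi (k \<cdot> e)" and e: "e \<in> Hom C A B" and k: "k \<in> Hom C B D"
  shows "strong_epi k"
  unfolding strong_epi_def
proof (intro conjI allI impI)
  show "k \<in> Arr C" using k by (rule HomD)
  fix m u v
  assume A: "monomorphism C m \<and> u \<in> Hom C (Dom C k) (Dom C m) \<and>
    v \<in> Hom C (Cod C k) (Cod C m) \<and> m \<cdot> u = v \<cdot> k"
  have m: "m \<in> Hom C (Dom C m) (Cod C m)" using A by (auto simp: monomorphism_def Hom_def)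
  have u: "u \<in> Hom C B (Dom C m)" and v: "v \<in> Hom C D (Cod C m)" using A HomD[OF k] by auto
  have "m \<cdot> (u \<cdot> e) = v \<cdot> (k \<cdot> e)"
    using A comp_assoc[OF e u m] comp_assoc[OF e k v] by simp
  then show "\<exists>d \<in> Hom C (Cod C k) (Dom C m). m \<cdot> d = v"
    using strong_epi_lift[OF ke comp_hom[OF e k] _ m comp_hom[OF e u] v] A HomD[OF k] by auto
qed

lemma coequaliser_comp_iso:
  assumes q: "is_coequaliser C f g q" "q \<in> Hom C A B"
    and m: "m \<in> Hom C B D" "d \<in> Hom C D B" "m \<cdot> d = Idt C D" "d \<cdot> m = Idt C B"
  shows "is_coequaliser C f g (m \<cdot> q)"
proof -
  obtain P where fg: "f \<in> Hom C P A" "g \<in> Hom C P A" "q \<cdot> f = q \<cdot> g"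
    using coequaliser_homs[OF q(1)] q(2) by (metis HomD(2))
  have mq: "m \<cdot> q \<in> Hom C A D" using q m comp_hom by blast
  have eq: "(m \<cdot> q) \<cdot> f = (m \<cdot> q) \<cdot> g"
    using comp_assoc[OF fg(1) q(2) m(1)] comp_assoc[OF fg(2) q(2) m(1)] fg(3) by simp
  have "\<exists>!h. h \<in> Hom C D T \<and> h \<cdot> (m \<cdot> q) = k" if k: "k \<in> Hom C A T" "k \<cdot> f = k \<cdot> g" for k T
  proof -
    obtain h where h: "h \<in> Hom C B T" "h \<cdot> q = k"
      and uniq: "\<And>h'. h' \<in> Hom C B T \<Longrightarrow> h' \<cdot> q = k \<Longrightarrow> h' = h"
      using coequaliser_factor[OF q k] by blast
    have "h \<cdot> d \<cdot> (m \<cdot> q) = h \<cdot> (d \<cdot> m \<cdot> q)"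
      using comp_assoc[OF mq m(2) h(1)] comp_assoc[OF q(2) m(1,2)] by simp
    also have "\<dots> = k" using m(4) comp_idt_left[OF q(2)] h(2) by simp
    finally have *: "h \<cdot> d \<cdot> (m \<cdot> q) = k" .
    have "h' = h \<cdot> d" if h': "h' \<in> Hom C D T" "h' \<cdot> (m \<cdot> q) = k" for h'
    proof -
      have "h' \<cdot> m = h"
        using uniq[OF comp_hom[OF m(1) h'(1)]] comp_assoc[OF q(2) m(1) h'(1)] h'(2) by simp
      then show ?thesis
        using comp_assoc[OF m(2,1) h'(1)] m(3) comp_idt_right[OF h'(1)] by simp
    qed
    then show ?thesis using * comp_hom[OF m(2) h(1)] by blast
  qed
  then show ?thesis
    unfolding is_coequaliser_def using fg eq HomD[OF mq] by (auto simp: Hom_def)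
qed

end


section \<open>Products, pullbacks and images\<close>

text \<open>The index category \<open>0 \<rightarrow> 2 \<leftarrow> 1\<close> of pullbacks: the arrows \<open>0\<close>, \<open>1\<close>, \<open>2\<close> are the identities, \<open>3\<close> and
  \<open>4\<close> are the legs. In a composable pair one factor is an identity.\<close>

definition cospan_shape :: "(nat, nat) category" where
  "cospan_shape = \<lparr>Obj = {0, 1, 2}, Arr = {0, 1, 2, 3, 4},
     Dom = (\<lambda>a. if a = 3 then 0 else if a = 4 then 1 else a),
     Cod = (\<lambda>a. if a = 3 \<or> a = 4 then 2 else a),
     Idt = (\<lambda>i. i), Comp = (\<lambda>b a. if b < 3 then a else b)\<rparr>"

definition pair_shape :: "(nat, nat) category" where
  "pair_shape = \<lparr>Obj = {0, 1}, Arr = {0, 1}, Dom = (\<lambda>a. a), Cod = (\<lambda>a. a),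
     Idt = (\<lambda>i. i), Comp = (\<lambda>b a. a)\<rparr>"

lemma category_cospan_shape: "category cospan_shape"
  by unfold_locales (auto simp: cospan_shape_def Hom_def split: if_splits)

lemma category_pair_shape: "category pair_shape"
  by unfold_locales (auto simp: pair_shape_def Hom_def)

context finitely_complete_category
begin

lemma product_exists:
  assumes A: "A \<in> Obj C" and B: "B \<in> Obj C"
  shows "\<exists>P p q. is_product C A B P p q"
proof -
  define Fo where "Fo = (\<lambda>j::nat. if j = 0 then A else B)"
  define Fa where "Fa = (\<lambda>j. Idt C (Fo j))"
  have Fo: "Fo j \<in> Obj C" for j using A B by (simp add: Fo_def)
  have "cat_functor pair_shape C Fo Fa"
    unfolding cat_functor_def cat_functor_axioms_def
    using category_pair_shape category_axioms Fo idt_hom comp_idt_right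
    by (auto simp: pair_shape_def Hom_def Fa_def comp_idt_right[OF idt_hom])
  then obtain P c where lim: "is_limit pair_shape C Fo Fa P c"
    using finite_limits[of pair_shape Fo Fa] by (auto simp: pair_shape_def)
  have cone: "is_cone pair_shape C Fo Fa T b \<longleftrightarrow> T \<in> Obj C \<and> b 0 \<in> Hom C T A \<and> b 1 \<in> Hom C T B" for T b
    using comp_idt_left unfolding is_cone_def pair_shape_def Fa_def by (auto simp: Fo_def)
  have "is_product C A B P (c 0) (c 1)"
    unfolding is_product_def
  proof (intro conjI allI ballI)
    show "P \<in> Obj C" "c 0 \<in> Hom C P A" "c 1 \<in> Hom C P B"
      using lim cone unfolding is_limit_def by auto
    fix T f g assume f: "f \<in> Hom C T A" and g: "g \<in> Hom C T B"
    have "is_cone pair_shape C Fo Fa T (\<lambda>j. if j = 0 then f else g)"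
      unfolding cone using f g HomD(4)[OF f] by simp
    then have "\<exists>!h. h \<in> Hom C T P \<and> (\<forall>j\<in>Obj pair_shape. c j \<cdot> h = (if j = 0 then f else g))"
      using lim unfolding is_limit_def by blast
    then show "\<exists>!h. h \<in> Hom C T P \<and> c 0 \<cdot> h = f \<and> c 1 \<cdot> h = g"
      by (simp add: pair_shape_def)
  qed
  then show ?thesis by blast
qed

lemma pullback_exists:
  assumes f: "f \<in> Hom C A D" and g: "g \<in> Hom C B D"
  shows "\<exists>P p q. is_pullback C f g P p q"
proof -
  define Fo where "Fo = (\<lambda>j::nat. if j = 0 then A else if j = 1 then B else D)"
  define Fa where "Fa = (\<lambda>j. if j = 3 then f else if j = 4 then g else Idt C (Fo j))"
  have Fo: "Fo j \<in> Obj C" for j using HomD[OF f] HomD[OF g] by (simp add: Fo_def)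
  have Fa: "Fa u \<in> Hom C (Fo (Dom cospan_shape u)) (Fo (Cod cospan_shape u))" if "u \<in> Arr cospan_shape" for u
    using that f g idt_hom HomD[OF f] HomD[OF g] by (auto simp: cospan_shape_def Fa_def Fo_def)
  have "cat_functor cospan_shape C Fo Fa"
    unfolding cat_functor_def cat_functor_axioms_def
  proof (intro conjI allI impI)
    show "category cospan_shape" "category C" by (fact category_cospan_shape category_axioms)+
    show "Fo j \<in> Obj C" for j by (rule Fo)
    show "Fa u \<in> Hom C (Fo i) (Fo j)" if "u \<in> Hom cospan_shape i j" for u i j
      using Fa[of u] that by (auto simp: Hom_def)
    show "Fa (Idt cospan_shape j) = Idt C (Fo j)" if "j \<in> Obj cospan_shape" for j
      using that by (auto simp: cospan_shape_def Fa_def)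
    fix u i j v k assume u: "u \<in> Hom cospan_shape i j" and v: "v \<in> Hom cospan_shape j k"
    show "Fa (v \<cdot>\<^bsub>cospan_shape\<^esub> u) = Fa v \<cdot> Fa u"
    proof (cases "v < 3")
      case True
      then have "Fa v = Idt C (Fo j)" "Cod cospan_shape u = j" "u \<in> Arr cospan_shape"
        using u v by (auto simp: cospan_shape_def Hom_def Fa_def split: if_splits)
      then show ?thesis using True comp_idt_left[OF Fa, of u] by (simp add: cospan_shape_def)
    next
      case False
      then have *: "Fa u = Idt C (Fo j)" "Dom cospan_shape v = j" "v \<in> Arr cospan_shape"
        "v \<cdot>\<^bsub>cospan_shape\<^esub> u = v"
        using u v by (auto simp: cospan_shape_def Hom_def Fa_def split: if_splits)
      then show ?thesis using comp_idt_right[OF Fa, of v] by simp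
    qed
  qed
  then obtain P c where lim: "is_limit cospan_shape C Fo Fa P c"
    using finite_limits[of cospan_shape Fo Fa] by (auto simp: cospan_shape_def)
  have cone: "is_cone cospan_shape C Fo Fa T b \<longleftrightarrow> T \<in> Obj C \<and> b 0 \<in> Hom C T A \<and> b 1 \<in> Hom C T B
      \<and> b 2 \<in> Hom C T D \<and> f \<cdot> b 0 = b 2 \<and> g \<cdot> b 1 = b 2" for T b
    using comp_idt_left unfolding is_cone_def cospan_shape_def Fa_def by (auto simp: Fo_def)
  have c: "P \<in> Obj C" "c 0 \<in> Hom C P A" "c 1 \<in> Hom C P B" "f \<cdot> c 0 = c 2" "g \<cdot> c 1 = c 2"
    using lim cone unfolding is_limit_def by auto
  have univ: "\<exists>!h. h \<in> Hom C T P \<and> c 0 \<cdot> h = u \<and> c 1 \<cdot> h = v"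
    if u: "u \<in> Hom C T A" and v: "v \<in> Hom C T B" and eq: "f \<cdot> u = g \<cdot> v" for T u v
  proof -
    define b where "b = (\<lambda>j::nat. if j = 0 then u else if j = 1 then v else f \<cdot> u)"
    have "is_cone cospan_shape C Fo Fa T b"
      unfolding cone b_def using u v eq HomD(4)[OF u] comp_hom[OF u f] by simp
    then have "\<exists>!h. h \<in> Hom C T P \<and> (\<forall>j\<in>Obj cospan_shape. c j \<cdot> h = b j)"
      using lim unfolding is_limit_def by blast
    moreover have "(\<forall>j\<in>Obj cospan_shape. c j \<cdot> h = b j) \<longleftrightarrow> c 0 \<cdot> h = u \<and> c 1 \<cdot> h = v"
      \<comment> \<open>the leg of the cone at the vertex \<open>2\<close> is determined by the one at \<open>0\<close>\<close>
      if h: "h \<in> Hom C T P" for h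
      using comp_assoc[OF h c(2) f] c(4) by (auto simp: cospan_shape_def b_def)
    ultimately show ?thesis by (metis (no_types, lifting))
  qed
  have "is_pullback C f g P (c 0) (c 1)"
    unfolding is_pullback_def using HomD[OF f] HomD[OF g] c univ by auto
  then show ?thesis by blast
qed

lemma pullback_homs:
  assumes "is_pullback C f g P p q" "f \<in> Hom C A D" "g \<in> Hom C B D"
  shows "p \<in> Hom C P A" "q \<in> Hom C P B" "f \<cdot> p = g \<cdot> q"
  using assms unfolding is_pullback_def by (auto dest: HomD)

lemma pullback_factor:
  assumes "is_pullback C f g P p q" "f \<in> Hom C A D" "g \<in> Hom C B D"
    "u \<in> Hom C T A" "v \<in> Hom C T B" "f \<cdot> u = g \<cdot> v"
  shows "\<exists>!h. h \<in> Hom C T P \<and> p \<cdot> h = u \<and> q \<cdot> h = v"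
proof -
  have "Dom C f = A" "Dom C g = B" using assms HomD by blast+
  then show ?thesis using assms unfolding is_pullback_def by blast
qed

lemma chosen_product_is_product:
  assumes "A \<in> Obj C" "B \<in> Obj C"
  shows "is_product C A B (prd C A B) (prj1 C A B) (prj2 C A B)"
proof -
  obtain P p q where "is_product C A B P p q" using product_exists[OF assms] by blast
  then have "(\<lambda>(P, p, q). is_product C A B P p q) (P, p, q)" by simp
  then have "(\<lambda>(P, p, q). is_product C A B P p q) (SOME (P, p, q). is_product C A B P p q)"
    by (rule someI)
  then show ?thesis
    unfolding prd_def prj1_def prj2_def chosen_product_def by (simp add: case_prod_unfold)
qed

lemma prj_hom:
  assumes "A \<in> Obj C" "B \<in> Obj C"
  shows "prj1 C A B \<in> Hom C (prd C A B) A" "prj2 C A B \<in> Hom C (prd C A B) B"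
  using chosen_product_is_product[OF assms] by (auto simp: is_product_def)

lemma tuple_props:
  assumes f: "f \<in> Hom C T A" and g: "g \<in> Hom C T B"
  shows "tuple C f g \<in> Hom C T (prd C A B)" "prj1 C A B \<cdot> tuple C f g = f" "prj2 C A B \<cdot> tuple C f g = g"
proof -
  have "\<exists>!h. h \<in> Hom C T (prd C A B) \<and> prj1 C A B \<cdot> h = f \<and> prj2 C A B \<cdot> h = g"
    using chosen_product_is_product[of A B] HomD(5)[OF f] HomD(5)[OF g] f g unfolding is_product_def by blast
  from theI'[OF this] show "tuple C f g \<in> Hom C T (prd C A B)"
    "prj1 C A B \<cdot> tuple C f g = f" "prj2 C A B \<cdot> tuple C f g = g"
    using HomD[OF f] HomD[OF g] unfolding tuple_def by auto
qed

lemma product_ext: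
  assumes AB: "A \<in> Obj C" "B \<in> Obj C"
    and h: "h \<in> Hom C T (prd C A B)" and k: "k \<in> Hom C T (prd C A B)"
    and eq: "prj1 C A B \<cdot> h = prj1 C A B \<cdot> k" "prj2 C A B \<cdot> h = prj2 C A B \<cdot> k"
  shows "h = k"
proof -
  have "prj1 C A B \<cdot> k \<in> Hom C T A" "prj2 C A B \<cdot> k \<in> Hom C T B"
    using prj_hom[OF AB] k comp_hom by blast+
  then show ?thesis
    using chosen_product_is_product[OF AB] h k eq unfolding is_product_def by metis
qed

end

context regular_category
begin

text \<open>Locally every element of the codomain of a regular epimorphism has a preimage.\<close>

lemma regular_epi_cover:
  assumes e: "regular_epi C e" "e \<in> Hom C A B" and y: "y \<in> Hom C T B"
  shows "\<exists>U c x. regular_epi C c \<and> c \<in> Hom C U T \<and> x \<in> Hom C U A \<and> e \<cdot> x = y \<cdot> c"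
proof -
  obtain P p q where pb: "is_pullback C y e P p q" using pullback_exists[OF y e(2)] by blast
  then show ?thesis
    using regular_epi_stable[OF pb e(1)] pullback_homs[OF pb y e(2)] by metis
qed

text \<open>Existence of factorisations: for the coequaliser \<open>e\<close> of the kernel pair of \<open>f\<close>, two
  elements of its codomain which the comparison arrow identifies lift along \<open>e\<close>, after passing to
  covers, to elements which \<open>f\<close> identifies and hence \<open>e\<close> identifies as well.\<close>

lemma regular_factorisation:
  assumes f: "f \<in> Hom C A B"
  shows "\<exists>I e m. monomorphism C m \<and> m \<in> Hom C I B \<and> regular_epi C e \<and> e \<in> Hom C A I \<and> m \<cdot> e = f"
proof -
  obtain P p q where pb: "is_pullback C f f P p q" using pullback_exists[OF f f] by blast
  then obtain e where coeq: "is_coequaliser C p q e" using kernel_pair_coequaliser by blast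
  note pq = pullback_homs[OF pb f f]
  obtain I where e: "e \<in> Hom C A I" "e \<cdot> p = e \<cdot> q"
    using coequaliser_homs[OF coeq] pq by (metis HomD(3))
  have re: "regular_epi C e" using coeq by (auto simp: regular_epi_def)
  obtain m where m: "m \<in> Hom C I B" "m \<cdot> e = f"
    using coequaliser_factor[OF coeq e(1) f pq(3)] by blast
  have "a = b" if a: "a \<in> Hom C T I" and b: "b \<in> Hom C T I" and eq: "m \<cdot> a = m \<cdot> b" for T a b
  proof -
    obtain U c x where c: "regular_epi C c" "c \<in> Hom C U T" and x: "x \<in> Hom C U A" "e \<cdot> x = a \<cdot> c"
      using regular_epi_cover[OF re e(1) a] by blast
    obtain V d y where d: "regular_epi C d" "d \<in> Hom C V U" and y: "y \<in> Hom C V A" "e \<cdot> y = (b \<cdot> c) \<cdot> d"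
      using regular_epi_cover[OF re e(1) comp_hom[OF c(2) b]] by blast
    have xd: "x \<cdot> d \<in> Hom C V A" using comp_hom[OF d(2) x(1)] .
    have exd: "e \<cdot> (x \<cdot> d) = (a \<cdot> c) \<cdot> d" using comp_assoc[OF d(2) x(1) e(1)] x(2) by simp
    have "f \<cdot> (x \<cdot> d) = m \<cdot> ((a \<cdot> c) \<cdot> d)" using comp_assoc[OF xd e(1) m(1)] exd m(2) by simp
    also have "\<dots> = ((m \<cdot> a) \<cdot> c) \<cdot> d"
      using comp_assoc[OF d(2) comp_hom[OF c(2) a] m(1)] comp_assoc[OF c(2) a m(1)] by simp
    also have "\<dots> = m \<cdot> ((b \<cdot> c) \<cdot> d)"
      using comp_assoc[OF d(2) comp_hom[OF c(2) b] m(1)] comp_assoc[OF c(2) b m(1)] eq by simp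
    also have "\<dots> = f \<cdot> y" using comp_assoc[OF y(1) e(1) m(1)] y(2) m(2) by simp
    finally obtain h where h: "h \<in> Hom C V P" "p \<cdot> h = x \<cdot> d" "q \<cdot> h = y"
      using pullback_factor[OF pb f f xd y(1)] by blast
    have "e \<cdot> (x \<cdot> d) = e \<cdot> y"
      using comp_assoc[OF h(1) pq(1) e(1)] comp_assoc[OF h(1) pq(2) e(1)] h e(2) by simp
    then have "(a \<cdot> c) \<cdot> d = (b \<cdot> c) \<cdot> d" using exd y(2) by simp
    then have "a \<cdot> c = b \<cdot> c"
      using regular_epi_cancel[OF d comp_hom[OF c(2) a] comp_hom[OF c(2) b]] by blast
    then show "a = b" using regular_epi_cancel[OF c a b] by blast
  qed
  then have "monomorphism C m" unfolding monomorphism_def using HomD[OF m(1)] by auto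
  then show ?thesis using m re e(1) by blast
qed

text \<open>In a factorisation of a strong epimorphism the monomorphic part acquires a section by
  orthogonality, and a monomorphism with a section is invertible.\<close>

lemma strong_epi_regular:
  assumes f: "strong_epi f"
  shows "regular_epi C f"
proof -
  have fh: "f \<in> Hom C (Dom C f) (Cod C f)" using f by (simp add: strong_epi_def arr_hom)
  obtain I e m where m: "monomorphism C m" "m \<in> Hom C I (Cod C f)"
    and e: "regular_epi C e" "e \<in> Hom C (Dom C f) I" and me: "m \<cdot> e = f"
    using regular_factorisation[OF fh] by blast
  have idB: "Idt C (Cod C f) \<in> Hom C (Cod C f) (Cod C f)" using idt_hom HomD(5)[OF fh] by blast
  have idI: "Idt C I \<in> Hom C I I" using idt_hom HomD(5)[OF e(2)] by blast
  obtain d where d: "d \<in> Hom C (Cod C f) I" "m \<cdot> d = Idt C (Cod C f)"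
    using strong_epi_lift[OF f fh m e(2) idB] me comp_idt_left[OF fh] by auto
  have "m \<cdot> (d \<cdot> m) = m \<cdot> Idt C I"
    using comp_assoc[OF m(2) d(1) m(2)] d(2) comp_idt_left[OF m(2)] comp_idt_right[OF m(2)] by simp
  then have "d \<cdot> m = Idt C I" using monomorphism_cancel[OF m comp_hom[OF m(2) d(1)] idI] by blast
  then show ?thesis
    using coequaliser_comp_iso[OF _ e(2) m(2) d] e(1) me unfolding regular_epi_def by blast
qed

lemma regular_epi_comp:
  "\<lbrakk>regular_epi C e; e \<in> Hom C A B; regular_epi C k; k \<in> Hom C B D\<rbrakk> \<Longrightarrow> regular_epi C (k \<cdot> e)"
  by (rule strong_epi_regular, rule strong_epi_comp) (auto intro: regular_epi_strong)

lemma regular_epi_right_factor: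
  "\<lbrakk>regular_epi C (k \<cdot> e); e \<in> Hom C A B; k \<in> Hom C B D\<rbrakk> \<Longrightarrow> regular_epi C k"
  by (rule strong_epi_regular, rule strong_epi_right_factor) (auto intro: regular_epi_strong)

lemma regular_image_props:
  assumes f: "f \<in> Hom C A B"
  shows "\<exists>I e. monomorphism C (regular_image C f) \<and> regular_image C f \<in> Hom C I B \<and>
    regular_epi C e \<and> e \<in> Hom C A I \<and> regular_image C f \<cdot> e = f"
proof -
  let ?P = "\<lambda>m. monomorphism C m \<and>
     (\<exists>e. regular_epi C e \<and> e \<in> Hom C (Dom C f) (Dom C m) \<and> m \<cdot> e = f)"
  obtain I e m where "monomorphism C m" "m \<in> Hom C I B" "regular_epi C e" "e \<in> Hom C A I" "m \<cdot> e = f"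
    using regular_factorisation[OF f] by blast
  then have "?P m" using HomD[OF f] HomD[of m I B] by auto
  then have "?P (regular_image C f)" unfolding regular_image_def by (rule someI)
  then obtain e where m: "monomorphism C (regular_image C f)"
    and e: "regular_epi C e" "e \<in> Hom C A (Dom C (regular_image C f))" "regular_image C f \<cdot> e = f"
    using HomD[OF f] by auto
  have "regular_image C f \<in> Arr C" using m by (simp add: monomorphism_def)
  moreover have "Cod C (regular_image C f) = B"
    using comp_ends(3)[OF HomD(1)[OF e(2)] \<open>regular_image C f \<in> Arr C\<close>] e HomD[OF f] HomD[OF e(2)] by simp
  ultimately show ?thesis using m e by (auto simp: Hom_def)
qed

end


section \<open>Relations through their generalized elements\<close>

text \<open>The elements of \<open>R\<close> at all stages at once: the stage of \<open>(x, y)\<close> is the common domain of \<open>x\<close> and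
  \<open>y\<close>.\<close>

definition gpairs :: "('o, 'a) category \<Rightarrow> 'o \<Rightarrow> 'a \<Rightarrow> ('a \<times> 'a) set" where
  "gpairs C X R = {(x, y). \<exists>h \<in> Arr C. Cod C h = Dom C R \<and>
     x = leg1 C X R \<cdot>\<^bsub>C\<^esub> h \<and> y = leg2 C X R \<cdot>\<^bsub>C\<^esub> h}"

context finitely_complete_category
begin

lemma relation_hom: "relation_on C X R \<Longrightarrow> R \<in> Hom C (Dom C R) (prd C X X)"
  unfolding relation_on_def monomorphism_def by (auto simp: Hom_def)

lemma leg_homs:
  assumes "relation_on C X R"
  shows "leg1 C X R \<in> Hom C (Dom C R) X" "leg2 C X R \<in> Hom C (Dom C R) X"
  using comp_hom[OF relation_hom[OF assms]] prj_hom[of X X] assms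
  unfolding leg1_def leg2_def relation_on_def by auto

lemma comp_legs:
  assumes R: "relation_on C X R" and h: "h \<in> Hom C T (Dom C R)"
  shows "leg1 C X R \<cdot> h = prj1 C X X \<cdot> (R \<cdot> h)" "leg2 C X R \<cdot> h = prj2 C X X \<cdot> (R \<cdot> h)"
  using comp_assoc[OF h relation_hom[OF R]] prj_hom[of X X] R
  unfolding leg1_def leg2_def relation_on_def by auto

lemma legs_jointly_monic:
  assumes R: "relation_on C X R" and h: "h \<in> Hom C T (Dom C R)" and k: "k \<in> Hom C T (Dom C R)"
    and eq: "leg1 C X R \<cdot> h = leg1 C X R \<cdot> k" "leg2 C X R \<cdot> h = leg2 C X R \<cdot> k"
  shows "h = k"
proof -
  have X: "X \<in> Obj C" and m: "monomorphism C R" using R by (auto simp: relation_on_def)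
  note Rh = relation_hom[OF R]
  have "R \<cdot> h = R \<cdot> k"
    using product_ext[OF X X comp_hom[OF h Rh] comp_hom[OF k Rh]] eq
      comp_legs[OF R h] comp_legs[OF R k] by simp
  then show ?thesis using monomorphism_cancel[OF m Rh h k] by blast
qed

text \<open>Identifies the pairing of a jointly monic pair as a relation with that pair as its legs; kernel
  pairs and intersections are obtained from it.\<close>

lemma relation_of_jointly_monic:
  assumes p: "p \<in> Hom C P X" and q: "q \<in> Hom C P X"
    and jm: "\<And>T h k. \<lbrakk>h \<in> Hom C T P; k \<in> Hom C T P; p \<cdot> h = p \<cdot> k; q \<cdot> h = q \<cdot> k\<rbrakk> \<Longrightarrow> h = k"
  shows "relation_on C X (tuple C p q)" "Dom C (tuple C p q) = P"
    "leg1 C X (tuple C p q) = p" "leg2 C X (tuple C p q) = q"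
proof -
  have X: "X \<in> Obj C" using HomD[OF p] by simp
  note t = tuple_props[OF p q]
  show "Dom C (tuple C p q) = P" using HomD[OF t(1)] by simp
  show "leg1 C X (tuple C p q) = p" "leg2 C X (tuple C p q) = q"
    using t by (auto simp: leg1_def leg2_def)
  have "h = k" if h: "h \<in> Hom C T P" and k: "k \<in> Hom C T P" and eq: "tuple C p q \<cdot> h = tuple C p q \<cdot> k" for T h k
    using jm[OF h k] eq t comp_assoc[OF h t(1)] comp_assoc[OF k t(1)] prj_hom[OF X X] by metis
  then show "relation_on C X (tuple C p q)"
    unfolding relation_on_def monomorphism_def using HomD[OF t(1)] X by auto
qed

lemma gpairs_iff:
  assumes R: "relation_on C X R" and x: "x \<in> Hom C T X"
  shows "(x, y) \<in> gpairs C X R \<longleftrightarrow>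
    (\<exists>h \<in> Hom C T (Dom C R). leg1 C X R \<cdot> h = x \<and> leg2 C X R \<cdot> h = y)"
proof
  assume "(x, y) \<in> gpairs C X R"
  then obtain h where h: "h \<in> Arr C" "Cod C h = Dom C R" "x = leg1 C X R \<cdot> h" "y = leg2 C X R \<cdot> h"
    by (auto simp: gpairs_def)
  have "Dom C h = T"
    using comp_ends(2)[OF h(1) HomD(1)[OF leg_homs(1)[OF R]]] h HomD[OF leg_homs(1)[OF R]] HomD[OF x] by simp
  then show "\<exists>h \<in> Hom C T (Dom C R). leg1 C X R \<cdot> h = x \<and> leg2 C X R \<cdot> h = y"
    using h by (auto simp: Hom_def)
next
  assume "\<exists>h \<in> Hom C T (Dom C R). leg1 C X R \<cdot> h = x \<and> leg2 C X R \<cdot> h = y"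
  then show "(x, y) \<in> gpairs C X R" by (auto simp: gpairs_def Hom_def)
qed

lemma gpairsE:
  assumes "(x, y) \<in> gpairs C X R" "relation_on C X R"
  obtains T where "x \<in> Hom C T X" "y \<in> Hom C T X"
proof -
  obtain h where h: "h \<in> Arr C" "Cod C h = Dom C R" "x = leg1 C X R \<cdot> h" "y = leg2 C X R \<cdot> h"
    using assms by (auto simp: gpairs_def)
  then have "h \<in> Hom C (Dom C h) (Dom C R)" by (simp add: Hom_def)
  then show ?thesis using that comp_hom leg_homs[OF assms(2)] h by blast
qed

lemma gpairs_hom2:
  assumes "(x, y) \<in> gpairs C X R" "relation_on C X R" "x \<in> Hom C T X"
  shows "y \<in> Hom C T X"
  using gpairsE[OF assms(1,2)] assms(3) by (metis HomD(2))

lemma gpairs_hom1: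
  assumes "(x, y) \<in> gpairs C X R" "relation_on C X R" "y \<in> Hom C T X"
  shows "x \<in> Hom C T X"
  using gpairsE[OF assms(1,2)] assms(3) by (metis HomD(2))

lemma gpairs_legs: "relation_on C X R \<Longrightarrow> (leg1 C X R, leg2 C X R) \<in> gpairs C X R"
  using gpairs_iff[OF _ leg_homs(1)] idt_hom comp_idt_right leg_homs HomD(4) by metis

lemma gpairs_precomp:
  assumes R: "relation_on C X R" and xy: "(x, y) \<in> gpairs C X R" "x \<in> Hom C T X" and c: "c \<in> Hom C U T"
  shows "(x \<cdot> c, y \<cdot> c) \<in> gpairs C X R"
proof -
  obtain h where h: "h \<in> Hom C T (Dom C R)" "leg1 C X R \<cdot> h = x" "leg2 C X R \<cdot> h = y"
    using xy gpairs_iff[OF R] by blast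
  show ?thesis
    unfolding gpairs_iff[OF R comp_hom[OF c xy(2)]]
    using h comp_hom[OF c h(1)] comp_assoc[OF c h(1)] leg_homs[OF R] by metis
qed

text \<open>A Yoneda argument: the generic element of \<open>R\<close> is the pair of its own legs, and an inclusion of
  elements sends it to the required factorisation.\<close>

lemma subobj_le_iff_gpairs:
  assumes R: "relation_on C X R" and S: "relation_on C X S"
  shows "subobj_le C R S \<longleftrightarrow> gpairs C X R \<subseteq> gpairs C X S"
proof
  assume "subobj_le C R S"
  then obtain k where k: "k \<in> Hom C (Dom C R) (Dom C S)" "S \<cdot> k = R" by (auto simp: subobj_le_def)
  have legs: "leg1 C X R = leg1 C X S \<cdot> k" "leg2 C X R = leg2 C X S \<cdot> k"
    using comp_legs[OF S k(1)] k(2) by (auto simp: leg1_def leg2_def)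
  then have "(leg1 C X R, leg2 C X R) \<in> gpairs C X S"
    using gpairs_precomp[OF S gpairs_legs[OF S] leg_homs(1)[OF S] k(1)] by simp
  then show "gpairs C X R \<subseteq> gpairs C X S"
    using gpairs_precomp[OF S _ leg_homs(1)[OF R]] by (auto simp: gpairs_def[of C X R] arr_hom Hom_def)
next
  assume "gpairs C X R \<subseteq> gpairs C X S"
  then have "(leg1 C X R, leg2 C X R) \<in> gpairs C X S" using gpairs_legs[OF R] by blast
  then obtain k where k: "k \<in> Hom C (Dom C R) (Dom C S)" "leg1 C X S \<cdot> k = leg1 C X R" "leg2 C X S \<cdot> k = leg2 C X R"
    using gpairs_iff[OF S leg_homs(1)[OF R]] by blast
  have X: "X \<in> Obj C" using R by (simp add: relation_on_def)
  have "S \<cdot> k = R"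
    using product_ext[OF X X comp_hom[OF k(1) relation_hom[OF S]] relation_hom[OF R]] comp_legs[OF S k(1)] k
    by (simp add: leg1_def leg2_def)
  then show "subobj_le C R S" using k by (auto simp: subobj_le_def)
qed

lemma subobj_eq_iff_gpairs:
  "\<lbrakk>relation_on C X R; relation_on C X S\<rbrakk> \<Longrightarrow> subobj_eq C R S \<longleftrightarrow> gpairs C X R = gpairs C X S"
  unfolding subobj_eq_def using subobj_le_iff_gpairs by blast

lemma gpairs_eqI:
  assumes R: "relation_on C X R" and S: "relation_on C X S"
    and eq: "\<And>T x y. \<lbrakk>x \<in> Hom C T X; y \<in> Hom C T X\<rbrakk> \<Longrightarrow> (x, y) \<in> gpairs C X R \<longleftrightarrow> (x, y) \<in> gpairs C X S"
  shows "gpairs C X R = gpairs C X S"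
proof (intro subset_antisym subrelI)
  fix x y
  show "(x, y) \<in> gpairs C X S" if "(x, y) \<in> gpairs C X R"
    using gpairsE[OF that R] eq that by blast
  show "(x, y) \<in> gpairs C X R" if "(x, y) \<in> gpairs C X S"
    using gpairsE[OF that S] eq that by blast
qed

text \<open>Each of the three structure arrows amounts to membership of one generic pair: the pair of
  identities, the legs in reverse order, and the outer legs of the pullback of composable
  elements.\<close>

lemma equivalence_relation_iff_gpairs:
  "equivalence_relation C X R \<longleftrightarrow> relation_on C X R \<and>
     (\<forall>T. \<forall>x \<in> Hom C T X. (x, x) \<in> gpairs C X R) \<and> sym (gpairs C X R) \<and> trans (gpairs C X R)"
  (is "_ \<longleftrightarrow> _ \<and> ?refl \<and> ?sym \<and> ?trans")
proof (cases "relation_on C X R")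
  case R: True
  let ?l = "leg1 C X R" and ?r = "leg2 C X R" and ?G = "gpairs C X R"
  have X: "X \<in> Obj C" using R by (simp add: relation_on_def)
  have id: "Idt C X \<in> Hom C X X" using idt_hom X by blast
  note legs = leg_homs[OF R]
  have "(\<exists>d \<in> Hom C X (Dom C R). ?l \<cdot> d = Idt C X \<and> ?r \<cdot> d = Idt C X) \<longleftrightarrow> (Idt C X, Idt C X) \<in> ?G"
    using gpairs_iff[OF R id] by blast
  also have "\<dots> \<longleftrightarrow> ?refl"
    using gpairs_precomp[OF R _ id] comp_idt_left id by metis
  finally have refl: "(\<exists>d \<in> Hom C X (Dom C R). ?l \<cdot> d = Idt C X \<and> ?r \<cdot> d = Idt C X) \<longleftrightarrow> ?refl" .
  have "(\<exists>s \<in> Hom C (Dom C R) (Dom C R). ?l \<cdot> s = ?r \<and> ?r \<cdot> s = ?l) \<longleftrightarrow> (?r, ?l) \<in> ?G"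
    using gpairs_iff[OF R legs(2)] by blast
  also have "\<dots> \<longleftrightarrow> ?sym"
  proof
    assume *: "(?r, ?l) \<in> ?G"
    show ?sym
    proof (rule symI)
      fix x y assume "(x, y) \<in> ?G"
      then obtain h where "h \<in> Arr C" "Cod C h = Dom C R" "x = ?l \<cdot> h" "y = ?r \<cdot> h"
        by (auto simp: gpairs_def)
      then show "(y, x) \<in> ?G" using gpairs_precomp[OF R * legs(2), of h "Dom C h"] by (simp add: Hom_def)
    qed
  next
    assume ?sym then show "(?r, ?l) \<in> ?G" using gpairs_legs[OF R] by (auto dest: symD)
  qed
  finally have sym: "(\<exists>s \<in> Hom C (Dom C R) (Dom C R). ?l \<cdot> s = ?r \<and> ?r \<cdot> s = ?l) \<longleftrightarrow> ?sym" .
  have trans: "(\<forall>P u v. is_pullback C ?r ?l P u v \<longrightarrow>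
      (\<exists>t \<in> Hom C P (Dom C R). ?l \<cdot> t = ?l \<cdot> u \<and> ?r \<cdot> t = ?r \<cdot> v)) \<longleftrightarrow> ?trans" (is "?pb \<longleftrightarrow> _")
  proof
    assume pbs: ?pb
    obtain P u v where pb: "is_pullback C ?r ?l P u v" using pullback_exists[OF legs(2,1)] by blast
    note uv = pullback_homs[OF pb legs(2,1)]
    obtain t where t: "t \<in> Hom C P (Dom C R)" "?l \<cdot> t = ?l \<cdot> u" "?r \<cdot> t = ?r \<cdot> v" using pbs pb by blast
    show ?trans
    proof (rule transI)
      fix x y z assume xy: "(x, y) \<in> ?G" and yz: "(y, z) \<in> ?G"
      obtain T where x: "x \<in> Hom C T X" and y: "y \<in> Hom C T X" using gpairsE[OF xy R] by blast
      obtain h where h: "h \<in> Hom C T (Dom C R)" "?l \<cdot> h = x" "?r \<cdot> h = y" using xy gpairs_iff[OF R x] by blast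
      obtain k where k: "k \<in> Hom C T (Dom C R)" "?l \<cdot> k = y" "?r \<cdot> k = z" using yz gpairs_iff[OF R y] by blast
      obtain w where w: "w \<in> Hom C T P" "u \<cdot> w = h" "v \<cdot> w = k"
        using pullback_factor[OF pb legs(2,1) h(1) k(1)] h k by auto
      have "?l \<cdot> (t \<cdot> w) = x"
        using comp_assoc[OF w(1) t(1) legs(1)] comp_assoc[OF w(1) uv(1) legs(1)] t w h by simp
      moreover have "?r \<cdot> (t \<cdot> w) = z"
        using comp_assoc[OF w(1) t(1) legs(2)] comp_assoc[OF w(1) uv(2) legs(2)] t w k by simp
      ultimately show "(x, z) \<in> ?G" using gpairs_iff[OF R x] comp_hom[OF w(1) t(1)] by blast
    qed
  next
    assume tr: ?trans
    show ?pb
    proof (intro allI impI)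
      fix P u v assume pb: "is_pullback C ?r ?l P u v"
      note uv = pullback_homs[OF pb legs(2,1)]
      have "(?l \<cdot> u, ?r \<cdot> u) \<in> ?G" "(?l \<cdot> v, ?r \<cdot> v) \<in> ?G"
        using gpairs_precomp[OF R gpairs_legs[OF R] legs(1)] uv by blast+
      then have "(?l \<cdot> u, ?r \<cdot> v) \<in> ?G" using tr uv(3) by (metis transD)
      then show "\<exists>t \<in> Hom C P (Dom C R). ?l \<cdot> t = ?l \<cdot> u \<and> ?r \<cdot> t = ?r \<cdot> v"
        using gpairs_iff[OF R comp_hom[OF uv(1) legs(1)]] by blast
    qed
  qed
  show ?thesis unfolding equivalence_relation_def using R refl sym trans by simp
qed (simp add: equivalence_relation_def)

lemma equivalence_relationD:
  assumes "equivalence_relation C X R"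
  shows "relation_on C X R" "X \<in> Obj C"
    "x \<in> Hom C T X \<Longrightarrow> (x, x) \<in> gpairs C X R"
    "(x, y) \<in> gpairs C X R \<Longrightarrow> (y, x) \<in> gpairs C X R"
    "\<lbrakk>(x, y) \<in> gpairs C X R; (y, z) \<in> gpairs C X R\<rbrakk> \<Longrightarrow> (x, z) \<in> gpairs C X R"
  using assms unfolding equivalence_relation_iff_gpairs relation_on_def by (blast dest: symD transD)+

lemma kernel_relation_exists:
  assumes g: "g \<in> Hom C X Z"
  shows "\<exists>R. is_kernel_relation C g R"
proof -
  obtain P p q where pb: "is_pullback C g g P p q" using pullback_exists[OF g g] by blast
  note pq = pullback_homs[OF pb g g]
  have jm: "h = k" if h: "h \<in> Hom C T P" and k: "k \<in> Hom C T P" and eq: "p \<cdot> h = p \<cdot> k" "q \<cdot> h = q \<cdot> k" for T h k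
  proof -
    have "g \<cdot> (p \<cdot> h) = g \<cdot> (q \<cdot> h)" using comp_assoc[OF h pq(1) g] comp_assoc[OF h pq(2) g] pq by simp
    then show ?thesis
      using pullback_factor[OF pb g g comp_hom[OF h pq(1)] comp_hom[OF h pq(2)]] h k eq by metis
  qed
  then have "is_kernel_relation C g (tuple C p q)"
    using relation_of_jointly_monic[OF pq(1,2) jm] pb HomD[OF g] unfolding is_kernel_relation_def by simp
  then show ?thesis by blast
qed

lemma kernel_relation_gpairs:
  assumes R: "is_kernel_relation C g R" and g: "g \<in> Hom C X Z"
    and x: "x \<in> Hom C T X" and y: "y \<in> Hom C T X"
  shows "(x, y) \<in> gpairs C X R \<longleftrightarrow> g \<cdot> x = g \<cdot> y"
proof -
  have rel: "relation_on C X R" and pb: "is_pullback C g g (Dom C R) (leg1 C X R) (leg2 C X R)"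
    using R HomD[OF g] by (auto simp: is_kernel_relation_def)
  note legs = pullback_homs[OF pb g g]
  show ?thesis
  proof
    assume "(x, y) \<in> gpairs C X R"
    then obtain h where h: "h \<in> Hom C T (Dom C R)" "leg1 C X R \<cdot> h = x" "leg2 C X R \<cdot> h = y"
      using gpairs_iff[OF rel x] by blast
    then show "g \<cdot> x = g \<cdot> y"
      using comp_assoc[OF h(1) legs(1) g] comp_assoc[OF h(1) legs(2) g] legs(3) by simp
  next
    assume "g \<cdot> x = g \<cdot> y"
    then show "(x, y) \<in> gpairs C X R"
      using gpairs_iff[OF rel x] pullback_factor[OF pb g g x y] by blast
  qed
qed

lemma kernel_relation_props:
  assumes g: "g \<in> Hom C X Z"
  shows "equivalence_relation C X (kernel_relation C g)"
    "\<lbrakk>x \<in> Hom C T X; y \<in> Hom C T X\<rbrakk> \<Longrightarrow> (x, y) \<in> gpairs C X (kernel_relation C g) \<longleftrightarrow> g \<cdot> x = g \<cdot> y"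
proof -
  have K: "is_kernel_relation C g (kernel_relation C g)"
    unfolding kernel_relation_def using kernel_relation_exists[OF g] by (rule someI_ex)
  note mem = kernel_relation_gpairs[OF K g]
  show "\<lbrakk>x \<in> Hom C T X; y \<in> Hom C T X\<rbrakk> \<Longrightarrow> (x, y) \<in> gpairs C X (kernel_relation C g) \<longleftrightarrow> g \<cdot> x = g \<cdot> y"
    by (rule mem)
  have rel: "relation_on C X (kernel_relation C g)" using K HomD[OF g] by (simp add: is_kernel_relation_def)
  show "equivalence_relation C X (kernel_relation C g)"
    unfolding equivalence_relation_iff_gpairs
  proof (intro conjI allI symI transI)
    fix x y assume xy: "(x, y) \<in> gpairs C X (kernel_relation C g)"
    obtain T where x: "x \<in> Hom C T X" and y: "y \<in> Hom C T X" using gpairsE[OF xy rel] by blast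
    show "(y, x) \<in> gpairs C X (kernel_relation C g)" using xy mem[OF x y] mem[OF y x] by simp
    fix z assume yz: "(y, z) \<in> gpairs C X (kernel_relation C g)"
    have z: "z \<in> Hom C T X" using gpairs_hom2[OF yz rel y] .
    show "(x, z) \<in> gpairs C X (kernel_relation C g)"
      using xy yz mem[OF x y] mem[OF y z] mem[OF x z] by simp
  next
    fix T show "\<forall>x \<in> Hom C T X. (x, x) \<in> gpairs C X (kernel_relation C g)" using mem by blast
  qed (fact rel)
qed

text \<open>The intersection is the diagonal of the pullback of the two monomorphisms into \<open>X \<times> X\<close>.\<close>

lemma intersection_exists:
  assumes R: "equivalence_relation C X R" and S: "equivalence_relation C X S"
  shows "\<exists>M. equivalence_relation C X M \<and> gpairs C X M = gpairs C X R \<inter> gpairs C X S"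
proof -
  note relR = equivalence_relationD(1)[OF R] and relS = equivalence_relationD(1)[OF S]
  note Rh = relation_hom[OF relR] and Sh = relation_hom[OF relS]
  obtain P p q where pb: "is_pullback C R S P p q" using pullback_exists[OF Rh Sh] by blast
  note pq = pullback_homs[OF pb Rh Sh]
  let ?p1 = "leg1 C X R \<cdot> p" and ?p2 = "leg2 C X R \<cdot> p"
  have p12: "?p1 \<in> Hom C P X" "?p2 \<in> Hom C P X" using leg_homs[OF relR] pq comp_hom by blast+
  have S12: "?p1 = leg1 C X S \<cdot> q" "?p2 = leg2 C X S \<cdot> q"
    using comp_legs[OF relR pq(1)] comp_legs[OF relS pq(2)] pq(3) by auto
  have jm: "h = k" if h: "h \<in> Hom C T P" and k: "k \<in> Hom C T P" and eq: "?p1 \<cdot> h = ?p1 \<cdot> k" "?p2 \<cdot> h = ?p2 \<cdot> k" for T h k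
  proof -
    have ph: "p \<cdot> h = p \<cdot> k"
      using legs_jointly_monic[OF relR comp_hom[OF h pq(1)] comp_hom[OF k pq(1)]] eq
        comp_assoc[OF h pq(1)] comp_assoc[OF k pq(1)] leg_homs[OF relR] by metis
    have qh: "q \<cdot> h = q \<cdot> k"
      using legs_jointly_monic[OF relS comp_hom[OF h pq(2)] comp_hom[OF k pq(2)]] eq
        comp_assoc[OF h pq(2)] comp_assoc[OF k pq(2)] leg_homs[OF relS] S12 by metis
    have "R \<cdot> (p \<cdot> h) = S \<cdot> (q \<cdot> h)" using comp_assoc[OF h pq(1) Rh] comp_assoc[OF h pq(2) Sh] pq by simp
    then show ?thesis
      using pullback_factor[OF pb Rh Sh comp_hom[OF h pq(1)] comp_hom[OF h pq(2)]] h k ph qh by metis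
  qed
  define M where "M = tuple C ?p1 ?p2"
  have M: "relation_on C X M" "Dom C M = P" "leg1 C X M = ?p1" "leg2 C X M = ?p2"
    using relation_of_jointly_monic[OF p12 jm] unfolding M_def by auto
  have X: "X \<in> Obj C" using equivalence_relationD[OF R] by blast
  have "(x, y) \<in> gpairs C X M \<longleftrightarrow> (x, y) \<in> gpairs C X R \<and> (x, y) \<in> gpairs C X S" for x y
  proof
    assume "(x, y) \<in> gpairs C X M"
    then obtain h where h: "h \<in> Arr C" "Cod C h = P" "x = ?p1 \<cdot> h" "y = ?p2 \<cdot> h"
      using M by (auto simp: gpairs_def)
    have hh: "h \<in> Hom C (Dom C h) P" using h by (simp add: Hom_def)
    have "(?p1, ?p2) \<in> gpairs C X R" "(?p1, ?p2) \<in> gpairs C X S"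
      using gpairs_precomp[OF relR gpairs_legs[OF relR] leg_homs(1)[OF relR] pq(1)]
        gpairs_precomp[OF relS gpairs_legs[OF relS] leg_homs(1)[OF relS] pq(2)] S12 by simp_all
    then show "(x, y) \<in> gpairs C X R \<and> (x, y) \<in> gpairs C X S"
      using gpairs_precomp[OF relR _ p12(1) hh] gpairs_precomp[OF relS _ p12(1) hh] h by simp
  next
    assume xy: "(x, y) \<in> gpairs C X R \<and> (x, y) \<in> gpairs C X S"
    then obtain T where x: "x \<in> Hom C T X" using gpairsE relR by blast
    obtain h where h: "h \<in> Hom C T (Dom C R)" "leg1 C X R \<cdot> h = x" "leg2 C X R \<cdot> h = y"
      using xy gpairs_iff[OF relR x] by blast
    obtain k where k: "k \<in> Hom C T (Dom C S)" "leg1 C X S \<cdot> k = x" "leg2 C X S \<cdot> k = y"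
      using xy gpairs_iff[OF relS x] by blast
    have "R \<cdot> h = S \<cdot> k"
      using product_ext[OF X X comp_hom[OF h(1) Rh] comp_hom[OF k(1) Sh]]
        comp_legs[OF relR h(1)] comp_legs[OF relS k(1)] h k by simp
    then obtain w where w: "w \<in> Hom C T P" "p \<cdot> w = h" "q \<cdot> w = k"
      using pullback_factor[OF pb Rh Sh h(1) k(1)] by blast
    then show "(x, y) \<in> gpairs C X M"
      unfolding gpairs_iff[OF M(1) x] M(2-4)
      using comp_assoc[OF w(1) pq(1)] leg_homs[OF relR] h by metis
  qed
  then have G: "gpairs C X M = gpairs C X R \<inter> gpairs C X S" by auto
  then have "equivalence_relation C X M"
    using R S M(1) unfolding equivalence_relation_iff_gpairs by (auto intro: sym_Int trans_Int)
  then show ?thesis using G by blast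
qed

end

context regular_category
begin

text \<open>Regular epimorphisms are orthogonal to the monomorphism \<open>R\<close>, so a factorisation of
  \<open>\<langle>x, y\<rangle> \<cdot> c\<close> through \<open>R\<close> descends to one of \<open>\<langle>x, y\<rangle>\<close>.\<close>

lemma gpairs_local:
  assumes R: "relation_on C X R" and x: "x \<in> Hom C T X" and y: "y \<in> Hom C T X"
    and c: "regular_epi C c" "c \<in> Hom C U T" and xyc: "(x \<cdot> c, y \<cdot> c) \<in> gpairs C X R"
  shows "(x, y) \<in> gpairs C X R"
proof -
  have X: "X \<in> Obj C" and m: "monomorphism C R" using R by (auto simp: relation_on_def)
  note t = tuple_props[OF x y]
  obtain h where h: "h \<in> Hom C U (Dom C R)" "leg1 C X R \<cdot> h = x \<cdot> c" "leg2 C X R \<cdot> h = y \<cdot> c"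
    using xyc gpairs_iff[OF R comp_hom[OF c(2) x]] by blast
  have "R \<cdot> h = tuple C x y \<cdot> c"
    using product_ext[OF X X comp_hom[OF h(1) relation_hom[OF R]] comp_hom[OF c(2) t(1)]]
      comp_legs[OF R h(1)] h(2,3) comp_assoc[OF c(2) t(1)] prj_hom[OF X X] t(2,3) by metis
  then obtain d where d: "d \<in> Hom C T (Dom C R)" "R \<cdot> d = tuple C x y"
    using strong_epi_lift[OF regular_epi_strong[OF c(1)] c(2) m relation_hom[OF R] h(1) t(1)] by blast
  then show ?thesis
    unfolding gpairs_iff[OF R x] using comp_legs[OF R d(1)] t(2,3) by auto
qed

text \<open>An element of the image lifts to \<open>P\<close> after pulling back the regular epimorphic part of the
  factorisation; conversely the lift shows membership on a cover, whence membership. Composites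
  and images of relations are both special cases.\<close>

lemma gpairs_regular_image:
  assumes a: "a \<in> Hom C P X" and b: "b \<in> Hom C P X"
  defines "I \<equiv> regular_image C (tuple C a b)"
  shows "relation_on C X I"
    "\<lbrakk>x \<in> Hom C T X; y \<in> Hom C T X\<rbrakk> \<Longrightarrow> (x, y) \<in> gpairs C X I \<longleftrightarrow>
       (\<exists>U c h. regular_epi C c \<and> c \<in> Hom C U T \<and> h \<in> Hom C U P \<and> x \<cdot> c = a \<cdot> h \<and> y \<cdot> c = b \<cdot> h)"
proof -
  have X: "X \<in> Obj C" using HomD[OF a] by simp
  note t = tuple_props[OF a b]
  obtain D e where I: "monomorphism C I" "I \<in> Hom C D (prd C X X)" "regular_epi C e" "e \<in> Hom C P D" "I \<cdot> e = tuple C a b"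
    using regular_image_props[OF t(1)] unfolding I_def by blast
  show rel: "relation_on C X I" using I X HomD[OF I(2)] by (simp add: relation_on_def)
  have D: "Dom C I = D" using HomD[OF I(2)] by simp
  note legs = leg_homs[OF rel, unfolded D]
  have le: "leg1 C X I \<cdot> e = a" "leg2 C X I \<cdot> e = b"
    using comp_legs[OF rel, of e P] D I t by auto
  assume x: "x \<in> Hom C T X" and y: "y \<in> Hom C T X"
  show "(x, y) \<in> gpairs C X I \<longleftrightarrow>
       (\<exists>U c h. regular_epi C c \<and> c \<in> Hom C U T \<and> h \<in> Hom C U P \<and> x \<cdot> c = a \<cdot> h \<and> y \<cdot> c = b \<cdot> h)"
  proof
    assume "(x, y) \<in> gpairs C X I"
    then obtain k where k: "k \<in> Hom C T D" "leg1 C X I \<cdot> k = x" "leg2 C X I \<cdot> k = y"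
      using gpairs_iff[OF rel x] D by blast
    obtain U c h where c: "regular_epi C c" "c \<in> Hom C U T" and h: "h \<in> Hom C U P" "e \<cdot> h = k \<cdot> c"
      using regular_epi_cover[OF I(3,4) k(1)] by blast
    have "x \<cdot> c = a \<cdot> h" "y \<cdot> c = b \<cdot> h"
      using comp_assoc[OF c(2) k(1)] comp_assoc[OF h(1) I(4)] legs k h le by metis+
    then show "\<exists>U c h. regular_epi C c \<and> c \<in> Hom C U T \<and> h \<in> Hom C U P \<and> x \<cdot> c = a \<cdot> h \<and> y \<cdot> c = b \<cdot> h"
      using c h by blast
  next
    assume "\<exists>U c h. regular_epi C c \<and> c \<in> Hom C U T \<and> h \<in> Hom C U P \<and> x \<cdot> c = a \<cdot> h \<and> y \<cdot> c = b \<cdot> h"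
    then obtain U c h where c: "regular_epi C c" "c \<in> Hom C U T" and h: "h \<in> Hom C U P"
      and eq: "x \<cdot> c = a \<cdot> h" "y \<cdot> c = b \<cdot> h" by blast
    have "(a, b) \<in> gpairs C X I"
      using gpairs_precomp[OF rel gpairs_legs[OF rel] legs(1) I(4)] le by simp
    then have "(x \<cdot> c, y \<cdot> c) \<in> gpairs C X I" using gpairs_precomp[OF rel _ a h] eq by simp
    then show "(x, y) \<in> gpairs C X I" using gpairs_local[OF rel x y c] by blast
  qed
qed

lemma gpairs_rel_comp:
  assumes R: "relation_on C X R" and S: "relation_on C X S"
  shows "relation_on C X (rel_comp C X R S)"
    "\<lbrakk>x \<in> Hom C T X; z \<in> Hom C T X\<rbrakk> \<Longrightarrow> (x, z) \<in> gpairs C X (rel_comp C X R S) \<longleftrightarrow>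
       (\<exists>U c y. regular_epi C c \<and> c \<in> Hom C U T \<and> (x \<cdot> c, y) \<in> gpairs C X S \<and> (y, z \<cdot> c) \<in> gpairs C X R)"
proof -
  note lR = leg_homs[OF R] and lS = leg_homs[OF S]
  define Q where "Q = (SOME (P, u, v). is_pullback C (leg2 C X S) (leg1 C X R) P u v)"
  define P where "P = fst Q"
  define u where "u = fst (snd Q)"
  define v where "v = snd (snd Q)"
  have "\<exists>Q. (\<lambda>(P, u, v). is_pullback C (leg2 C X S) (leg1 C X R) P u v) Q"
    using pullback_exists[OF lS(2) lR(1)] by auto
  from someI_ex[OF this] have pb: "is_pullback C (leg2 C X S) (leg1 C X R) P u v"
    unfolding P_def u_def v_def Q_def by (simp add: case_prod_unfold)
  have comp: "rel_comp C X R S = regular_image C (tuple C (leg1 C X S \<cdot> u) (leg2 C X R \<cdot> v))"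
    unfolding rel_comp_def Q_def[symmetric] by (simp add: case_prod_unfold P_def u_def v_def)
  note uv = pullback_homs[OF pb lS(2) lR(1)]
  note su = comp_hom[OF uv(1) lS(1)] and rv = comp_hom[OF uv(2) lR(2)]
  show "relation_on C X (rel_comp C X R S)" unfolding comp by (rule gpairs_regular_image(1)[OF su rv])
  assume x: "x \<in> Hom C T X" and z: "z \<in> Hom C T X"
  show "(x, z) \<in> gpairs C X (rel_comp C X R S) \<longleftrightarrow>
       (\<exists>U c y. regular_epi C c \<and> c \<in> Hom C U T \<and> (x \<cdot> c, y) \<in> gpairs C X S \<and> (y, z \<cdot> c) \<in> gpairs C X R)"
    unfolding comp gpairs_regular_image(2)[OF su rv x z]
  proof
    assume "\<exists>U c h. regular_epi C c \<and> c \<in> Hom C U T \<and> h \<in> Hom C U P \<and>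
      x \<cdot> c = (leg1 C X S \<cdot> u) \<cdot> h \<and> z \<cdot> c = (leg2 C X R \<cdot> v) \<cdot> h"
    then obtain U c h where c: "regular_epi C c" "c \<in> Hom C U T" and h: "h \<in> Hom C U P"
      and eq: "x \<cdot> c = (leg1 C X S \<cdot> u) \<cdot> h" "z \<cdot> c = (leg2 C X R \<cdot> v) \<cdot> h" by blast
    let ?y = "(leg2 C X S \<cdot> u) \<cdot> h"
    have "(x \<cdot> c, ?y) \<in> gpairs C X S"
      using gpairs_precomp[OF S gpairs_precomp[OF S gpairs_legs[OF S] lS(1) uv(1)] su h] eq by simp
    moreover have "(?y, z \<cdot> c) \<in> gpairs C X R"
      using gpairs_precomp[OF R gpairs_precomp[OF R gpairs_legs[OF R] lR(1) uv(2)] comp_hom[OF uv(2) lR(1)] h] eq uv(3) by simp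
    ultimately show "\<exists>U c y. regular_epi C c \<and> c \<in> Hom C U T \<and> (x \<cdot> c, y) \<in> gpairs C X S \<and> (y, z \<cdot> c) \<in> gpairs C X R"
      using c by blast
  next
    assume "\<exists>U c y. regular_epi C c \<and> c \<in> Hom C U T \<and> (x \<cdot> c, y) \<in> gpairs C X S \<and> (y, z \<cdot> c) \<in> gpairs C X R"
    then obtain U c y where c: "regular_epi C c" "c \<in> Hom C U T"
      and xy: "(x \<cdot> c, y) \<in> gpairs C X S" and yz: "(y, z \<cdot> c) \<in> gpairs C X R" by blast
    note xc = comp_hom[OF c(2) x]
    have y: "y \<in> Hom C U X" using gpairs_hom2[OF xy S xc] .
    obtain h where h: "h \<in> Hom C U (Dom C S)" "leg1 C X S \<cdot> h = x \<cdot> c" "leg2 C X S \<cdot> h = y"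
      using xy gpairs_iff[OF S xc] by blast
    obtain k where k: "k \<in> Hom C U (Dom C R)" "leg1 C X R \<cdot> k = y" "leg2 C X R \<cdot> k = z \<cdot> c"
      using yz gpairs_iff[OF R y] by blast
    obtain w where w: "w \<in> Hom C U P" "u \<cdot> w = h" "v \<cdot> w = k"
      using pullback_factor[OF pb lS(2) lR(1) h(1) k(1)] h k by auto
    have "x \<cdot> c = (leg1 C X S \<cdot> u) \<cdot> w" "z \<cdot> c = (leg2 C X R \<cdot> v) \<cdot> w"
      using comp_assoc[OF w(1) uv(1) lS(1)] comp_assoc[OF w(1) uv(2) lR(2)] w h k by auto
    then show "\<exists>U c h. regular_epi C c \<and> c \<in> Hom C U T \<and> h \<in> Hom C U P \<and>
      x \<cdot> c = (leg1 C X S \<cdot> u) \<cdot> h \<and> z \<cdot> c = (leg2 C X R \<cdot> v) \<cdot> h" using c w(1) by blast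
  qed
qed

lemma gpairs_rel_image:
  assumes f: "f \<in> Hom C X Y" and S: "relation_on C X S"
  shows "relation_on C Y (rel_image C f S)"
    "\<lbrakk>y \<in> Hom C T Y; y' \<in> Hom C T Y\<rbrakk> \<Longrightarrow> (y, y') \<in> gpairs C Y (rel_image C f S) \<longleftrightarrow>
       (\<exists>U c x x'. regular_epi C c \<and> c \<in> Hom C U T \<and> (x, x') \<in> gpairs C X S \<and>
          f \<cdot> x = y \<cdot> c \<and> f \<cdot> x' = y' \<cdot> c)"
proof -
  have X: "X \<in> Obj C" and Y: "Y \<in> Obj C" using HomD[OF f] by auto
  note legs = leg_homs[OF S] and Sh = relation_hom[OF S]
  let ?a = "f \<cdot> leg1 C X S" and ?b = "f \<cdot> leg2 C X S"
  note a = comp_hom[OF legs(1) f] and b = comp_hom[OF legs(2) f]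
  note p = prj_hom[OF X X] and pY = prj_hom[OF Y Y]
  note ff = tuple_props[OF comp_hom[OF p(1) f] comp_hom[OF p(2) f]]
  have pm: "prod_map C f f = tuple C (f \<cdot> prj1 C X X) (f \<cdot> prj2 C X X)"
    using HomD[OF f] by (simp add: prod_map_def)
  have "prod_map C f f \<cdot> S = tuple C ?a ?b"
  proof (rule product_ext[OF Y Y])
    show "prod_map C f f \<cdot> S \<in> Hom C (Dom C S) (prd C Y Y)" using comp_hom[OF Sh ff(1)] pm by simp
    show "tuple C ?a ?b \<in> Hom C (Dom C S) (prd C Y Y)" by (rule tuple_props[OF a b])
    show "prj1 C Y Y \<cdot> (prod_map C f f \<cdot> S) = prj1 C Y Y \<cdot> tuple C ?a ?b"
      using comp_assoc[OF Sh ff(1) pY(1)] comp_assoc[OF Sh p(1) f] ff(2) tuple_props[OF a b] pm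
      by (simp add: leg1_def)
    show "prj2 C Y Y \<cdot> (prod_map C f f \<cdot> S) = prj2 C Y Y \<cdot> tuple C ?a ?b"
      using comp_assoc[OF Sh ff(1) pY(2)] comp_assoc[OF Sh p(2) f] ff(3) tuple_props[OF a b] pm
      by (simp add: leg2_def)
  qed
  then have im: "rel_image C f S = regular_image C (tuple C ?a ?b)" by (simp add: rel_image_def)
  show "relation_on C Y (rel_image C f S)" unfolding im by (rule gpairs_regular_image(1)[OF a b])
  assume y: "y \<in> Hom C T Y" and y': "y' \<in> Hom C T Y"
  have "(\<exists>h \<in> Hom C U (Dom C S). v = ?a \<cdot> h \<and> w = ?b \<cdot> h) \<longleftrightarrow>
      (\<exists>x x'. (x, x') \<in> gpairs C X S \<and> f \<cdot> x = v \<and> f \<cdot> x' = w)" if v: "v \<in> Hom C U Y" for U v w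
  proof
    assume "\<exists>h \<in> Hom C U (Dom C S). v = ?a \<cdot> h \<and> w = ?b \<cdot> h"
    then obtain h where h: "h \<in> Hom C U (Dom C S)" "v = ?a \<cdot> h" "w = ?b \<cdot> h" by blast
    then show "\<exists>x x'. (x, x') \<in> gpairs C X S \<and> f \<cdot> x = v \<and> f \<cdot> x' = w"
      using gpairs_precomp[OF S gpairs_legs[OF S] legs(1) h(1)]
        comp_assoc[OF h(1) legs(1) f] comp_assoc[OF h(1) legs(2) f] by metis
  next
    assume "\<exists>x x'. (x, x') \<in> gpairs C X S \<and> f \<cdot> x = v \<and> f \<cdot> x' = w"
    then obtain x x' where x: "(x, x') \<in> gpairs C X S" "f \<cdot> x = v" "f \<cdot> x' = w" by blast
    obtain V where xV: "x \<in> Hom C V X" using gpairsE[OF x(1) S] by blast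
    have "V = U" using comp_hom[OF xV f] x(2) v by (auto simp: Hom_def)
    then obtain h where h: "h \<in> Hom C U (Dom C S)" "leg1 C X S \<cdot> h = x" "leg2 C X S \<cdot> h = x'"
      using x(1) gpairs_iff[OF S xV] by blast
    then show "\<exists>h \<in> Hom C U (Dom C S). v = ?a \<cdot> h \<and> w = ?b \<cdot> h"
      using comp_assoc[OF h(1) legs(1) f] comp_assoc[OF h(1) legs(2) f] x by metis
  qed
  then have "(\<exists>h \<in> Hom C U (Dom C S). y \<cdot> c = ?a \<cdot> h \<and> y' \<cdot> c = ?b \<cdot> h) \<longleftrightarrow>
      (\<exists>x x'. (x, x') \<in> gpairs C X S \<and> f \<cdot> x = y \<cdot> c \<and> f \<cdot> x' = y' \<cdot> c)" if "c \<in> Hom C U T" for U c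
    using comp_hom[OF that y] by blast
  then show "(y, y') \<in> gpairs C Y (rel_image C f S) \<longleftrightarrow>
       (\<exists>U c x x'. regular_epi C c \<and> c \<in> Hom C U T \<and> (x, x') \<in> gpairs C X S \<and>
          f \<cdot> x = y \<cdot> c \<and> f \<cdot> x' = y' \<cdot> c)"
    unfolding im gpairs_regular_image(2)[OF a b y y'] by blast
qed

end


section \<open>Local arguments and effective quotients\<close>

context regular_category
begin

lemma regular_epi_idt:
  assumes X: "X \<in> Obj C"
  shows "regular_epi C (Idt C X)"
proof (rule strong_epi_regular)
  have I: "Idt C X \<in> Hom C X X" using idt_hom X .
  show "strong_epi (Idt C X)"
    unfolding strong_epi_def using HomD[OF I] comp_idt_right by metis
qed

lemma regular_epi_factor:
  assumes e: "regular_epi C e" "e \<in> Hom C A B" and k: "k \<in> Hom C A D"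
    and le: "\<And>T x y. \<lbrakk>x \<in> Hom C T A; y \<in> Hom C T A; e \<cdot> x = e \<cdot> y\<rbrakk> \<Longrightarrow> k \<cdot> x = k \<cdot> y"
  shows "\<exists>h \<in> Hom C B D. h \<cdot> e = k"
proof -
  obtain f g where q: "is_coequaliser C f g e" using e by (auto simp: regular_epi_def)
  obtain P where fg: "f \<in> Hom C P A" "g \<in> Hom C P A" "e \<cdot> f = e \<cdot> g"
    using coequaliser_homs[OF q] e(2) by (metis HomD(2))
  then show ?thesis using coequaliser_factor[OF q e(2) k le[OF fg]] by blast
qed

text \<open>Every element of \<open>Y\<close> is locally of the form \<open>f \<cdot> x\<close>, so relations on \<open>Y\<close> can be compared on such
  elements only.\<close>

lemma gpairs_subset_on_cover:
  assumes f: "regular_epi C f" "f \<in> Hom C X Y"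
    and A: "relation_on C Y A" and B: "relation_on C Y B"
    and le: "\<And>T x x'. \<lbrakk>x \<in> Hom C T X; x' \<in> Hom C T X; (f \<cdot> x, f \<cdot> x') \<in> gpairs C Y A\<rbrakk>
      \<Longrightarrow> (f \<cdot> x, f \<cdot> x') \<in> gpairs C Y B"
  shows "gpairs C Y A \<subseteq> gpairs C Y B"
proof (rule subrelI)
  fix y y' assume yy: "(y, y') \<in> gpairs C Y A"
  obtain T where y: "y \<in> Hom C T Y" and y': "y' \<in> Hom C T Y" using gpairsE[OF yy A] by blast
  obtain U c x where c: "regular_epi C c" "c \<in> Hom C U T" and x: "x \<in> Hom C U X" "f \<cdot> x = y \<cdot> c"
    using regular_epi_cover[OF f y] by blast
  note yc = comp_hom[OF c(2) y] and yc' = comp_hom[OF c(2) y']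
  obtain V d x' where d: "regular_epi C d" "d \<in> Hom C V U" and x': "x' \<in> Hom C V X" "f \<cdot> x' = (y' \<cdot> c) \<cdot> d"
    using regular_epi_cover[OF f yc'] by blast
  have fx: "f \<cdot> (x \<cdot> d) = (y \<cdot> c) \<cdot> d" using comp_assoc[OF d(2) x(1) f(2)] x by simp
  have "((y \<cdot> c) \<cdot> d, (y' \<cdot> c) \<cdot> d) \<in> gpairs C Y A"
    using gpairs_precomp[OF A gpairs_precomp[OF A yy y c(2)] yc d(2)] .
  then have "((y \<cdot> c) \<cdot> d, (y' \<cdot> c) \<cdot> d) \<in> gpairs C Y B"
    using le[OF comp_hom[OF d(2) x(1)] x'(1)] fx x' by simp
  then show "(y, y') \<in> gpairs C Y B"
    using gpairs_local[OF B yc yc' d] gpairs_local[OF B y y' c] by blast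
qed

lemma rel_image_memI:
  assumes f: "f \<in> Hom C X Y" and S: "relation_on C X S" and xx: "(x, x') \<in> gpairs C X S"
  shows "(f \<cdot> x, f \<cdot> x') \<in> gpairs C Y (rel_image C f S)"
proof -
  obtain T where x: "x \<in> Hom C T X" and x': "x' \<in> Hom C T X" using gpairsE[OF xx S] by blast
  note fx = comp_hom[OF x f] and fx' = comp_hom[OF x' f]
  have T: "T \<in> Obj C" using HomD[OF x] by simp
  show ?thesis
    unfolding gpairs_rel_image(2)[OF f S fx fx']
    using regular_epi_idt[OF T] idt_hom[OF T] xx comp_idt_right[OF fx] comp_idt_right[OF fx'] by metis
qed

lemma gpairs_rel_compI:
  assumes R: "relation_on C X R" and S: "relation_on C X S"
    and xy: "(x, y) \<in> gpairs C X S" and yz: "(y, z) \<in> gpairs C X R"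
  shows "(x, z) \<in> gpairs C X (rel_comp C X R S)"
proof -
  obtain T where x: "x \<in> Hom C T X" and y: "y \<in> Hom C T X" using gpairsE[OF xy S] by blast
  have z: "z \<in> Hom C T X" using gpairs_hom2[OF yz R y] .
  have T: "T \<in> Obj C" using HomD[OF x] by simp
  show ?thesis
    unfolding gpairs_rel_comp(2)[OF R S x z]
    using regular_epi_idt[OF T] idt_hom[OF T] xy yz comp_idt_right[OF x] comp_idt_right[OF z] by metis
qed

end

context exact_category
begin

text \<open>Exactness: \<open>R\<close> is the kernel pair of some \<open>g\<close>. Since \<open>g\<close> factors through the coequaliser of
  \<open>R\<close>, that coequaliser identifies no more than \<open>g\<close> does.\<close>

lemma quotient_map_props:
  assumes R: "equivalence_relation C X R"
  shows "quotient_map C X R \<in> Hom C X (Cod C (quotient_map C X R))"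
    "regular_epi C (quotient_map C X R)"
    "\<lbrakk>x \<in> Hom C T X; y \<in> Hom C T X\<rbrakk> \<Longrightarrow>
      quotient_map C X R \<cdot> x = quotient_map C X R \<cdot> y \<longleftrightarrow> (x, y) \<in> gpairs C X R"
proof -
  let ?q = "quotient_map C X R"
  note rel = equivalence_relationD(1)[OF R]
  note legs = leg_homs[OF rel]
  obtain g where g: "g \<in> Arr C" "Dom C g = X" and K: "is_kernel_relation C g R" using effective[OF R] by blast
  have gh: "g \<in> Hom C X (Cod C g)" using g by (simp add: Hom_def)
  have "is_pullback C g g (Dom C R) (leg1 C X R) (leg2 C X R)" using K g by (simp add: is_kernel_relation_def)
  then have coeq: "is_coequaliser C (leg1 C X R) (leg2 C X R) ?q"
    unfolding quotient_map_def using kernel_pair_coequaliser by (blast intro: someI_ex)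
  obtain Z where q: "?q \<in> Hom C X Z" and qR: "?q \<cdot> leg1 C X R = ?q \<cdot> leg2 C X R"
    using coequaliser_homs[OF coeq] legs by (metis HomD(3))
  have "g \<cdot> leg1 C X R = g \<cdot> leg2 C X R"
    using kernel_relation_gpairs[OF K gh legs] gpairs_legs[OF rel] by simp
  then obtain m where m: "m \<in> Hom C Z (Cod C g)" "m \<cdot> ?q = g"
    using coequaliser_factor[OF coeq q gh] by blast
  show "?q \<in> Hom C X (Cod C ?q)" using q HomD[OF q] by simp
  show "regular_epi C ?q" using coeq unfolding regular_epi_def by blast
  assume x: "x \<in> Hom C T X" and y: "y \<in> Hom C T X"
  show "?q \<cdot> x = ?q \<cdot> y \<longleftrightarrow> (x, y) \<in> gpairs C X R"
  proof
    assume "?q \<cdot> x = ?q \<cdot> y"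
    then have "g \<cdot> x = g \<cdot> y" using comp_assoc[OF x q m(1)] comp_assoc[OF y q m(1)] m(2) by simp
    then show "(x, y) \<in> gpairs C X R" using kernel_relation_gpairs[OF K gh x y] by simp
  next
    assume "(x, y) \<in> gpairs C X R"
    then obtain h where h: "h \<in> Hom C T (Dom C R)" "leg1 C X R \<cdot> h = x" "leg2 C X R \<cdot> h = y"
      using gpairs_iff[OF rel x] by blast
    then show "?q \<cdot> x = ?q \<cdot> y"
      using comp_assoc[OF h(1) legs(1) q] comp_assoc[OF h(1) legs(2) q] qR by simp
  qed
qed

end


section \<open>The lattice of equivalence relations in an exact Goursat category\<close>

context exact_goursat_category
begin

text \<open>The Goursat identity, \<open>S \<circ> R \<circ> S \<subseteq> R \<circ> S \<circ> R\<close>, in terms of elements.\<close>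

lemma goursat_exchange:
  assumes R: "equivalence_relation C X R" and S: "equivalence_relation C X S"
    and x: "x \<in> Hom C T X"
    and "(x, a) \<in> gpairs C X S" "(a, b) \<in> gpairs C X R" "(b, y) \<in> gpairs C X S"
  obtains U c a' b' where "regular_epi C c" "c \<in> Hom C U T"
    "(x \<cdot> c, a') \<in> gpairs C X R" "(a', b') \<in> gpairs C X S" "(b', y \<cdot> c) \<in> gpairs C X R"
proof -
  note rR = equivalence_relationD(1)[OF R] and rS = equivalence_relationD(1)[OF S]
  note rSR = gpairs_rel_comp(1)[OF rS rR] and rRS = gpairs_rel_comp(1)[OF rR rS]
  have a: "a \<in> Hom C T X" using gpairs_hom2[OF assms(4) rS x] .
  have b: "b \<in> Hom C T X" using gpairs_hom2[OF assms(5) rR a] .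
  have y: "y \<in> Hom C T X" using gpairs_hom2[OF assms(6) rS b] .
  have "(x, y) \<in> gpairs C X (rel_comp C X (rel_comp C X S R) S)"
    using gpairs_rel_compI[OF rSR rS assms(4) gpairs_rel_compI[OF rS rR assms(5,6)]] .
  then have "(x, y) \<in> gpairs C X (rel_comp C X (rel_comp C X R S) R)"
    using goursat[OF R S] subobj_eq_iff_gpairs[OF gpairs_rel_comp(1)[OF rRS rR] gpairs_rel_comp(1)[OF rSR rS]]
    by simp
  then obtain U c a' where c: "regular_epi C c" "c \<in> Hom C U T" and a': "(x \<cdot> c, a') \<in> gpairs C X R"
      "(a', y \<cdot> c) \<in> gpairs C X (rel_comp C X R S)"
    using gpairs_rel_comp(2)[OF rRS rR x y] by blast
  note xc = comp_hom[OF c(2) x] and yc = comp_hom[OF c(2) y]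
  have a'h: "a' \<in> Hom C U X" using gpairs_hom2[OF a'(1) rR xc] .
  obtain V d b' where d: "regular_epi C d" "d \<in> Hom C V U" and b': "(a' \<cdot> d, b') \<in> gpairs C X S"
      "(b', (y \<cdot> c) \<cdot> d) \<in> gpairs C X R"
    using gpairs_rel_comp(2)[OF rR rS a'h yc] a'(2) by blast
  have "((x \<cdot> c) \<cdot> d, a' \<cdot> d) \<in> gpairs C X R" using gpairs_precomp[OF rR a'(1) xc d(2)] .
  then show ?thesis
    using that[OF regular_epi_comp[OF d c] comp_hom[OF d(2) c(2)]] b'
      comp_assoc[OF d(2) c(2) x] comp_assoc[OF d(2) c(2) y] by simp
qed

text \<open>The Goursat property gives transitivity: if \<open>y\<^sub>1, y\<^sub>2\<close> and \<open>y\<^sub>2, y\<^sub>3\<close> are related, lifting both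
  pairs to \<open>X\<close> gives two lifts of \<open>y\<^sub>2\<close>, which are related by the kernel pair \<open>K\<close> of \<open>f\<close>. This chain
  \<open>S \<circ> K \<circ> S\<close> can be exchanged for a chain \<open>K \<circ> S \<circ> K\<close>, in which \<open>f\<close> collapses the outer steps
  and leaves one element of \<open>S\<close> over \<open>y\<^sub>1, y\<^sub>3\<close>.\<close>

lemma equivalence_relation_image:
  assumes f: "regular_epi C f" "f \<in> Hom C X Y" and S: "equivalence_relation C X S"
  shows "equivalence_relation C Y (rel_image C f S)"
proof -
  note rS = equivalence_relationD(1)[OF S]
  let ?I = "rel_image C f S" and ?K = "kernel_relation C f"
  have rI: "relation_on C Y ?I" using gpairs_rel_image(1)[OF f(2) rS] .
  note K = kernel_relation_props[OF f(2)]
  note rK = equivalence_relationD(1)[OF K(1)]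
  show ?thesis
    unfolding equivalence_relation_iff_gpairs
  proof (intro conjI allI ballI symI transI)
    show "relation_on C Y ?I" by (rule rI)
  next
    fix T y assume y: "y \<in> Hom C T Y"
    obtain U c x where c: "regular_epi C c" "c \<in> Hom C U T" and x: "x \<in> Hom C U X" "f \<cdot> x = y \<cdot> c"
      using regular_epi_cover[OF f y] by blast
    have "(f \<cdot> x, f \<cdot> x) \<in> gpairs C Y ?I"
      using rel_image_memI[OF f(2) rS] equivalence_relationD(3)[OF S x(1)] by blast
    then show "(y, y) \<in> gpairs C Y ?I" using gpairs_local[OF rI y y c] x(2) by simp
  next
    fix y y' assume yy: "(y, y') \<in> gpairs C Y ?I"
    obtain T where y: "y \<in> Hom C T Y" "y' \<in> Hom C T Y" using gpairsE[OF yy rI] by blast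
    show "(y', y) \<in> gpairs C Y ?I"
      using yy equivalence_relationD(4)[OF S]
      unfolding gpairs_rel_image(2)[OF f(2) rS y] gpairs_rel_image(2)[OF f(2) rS y(2,1)] by blast
  next
    fix y1 y2 y3 assume y12: "(y1, y2) \<in> gpairs C Y ?I" and y23: "(y2, y3) \<in> gpairs C Y ?I"
    obtain T where y1: "y1 \<in> Hom C T Y" and y2: "y2 \<in> Hom C T Y" using gpairsE[OF y12 rI] by blast
    have y3: "y3 \<in> Hom C T Y" using gpairs_hom2[OF y23 rI y2] .
    obtain U c x1 x2 where c: "regular_epi C c" "c \<in> Hom C U T" and x12: "(x1, x2) \<in> gpairs C X S"
      and fx1: "f \<cdot> x1 = y1 \<cdot> c" and fx2: "f \<cdot> x2 = y2 \<cdot> c"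
      using y12 gpairs_rel_image(2)[OF f(2) rS y1 y2] by blast
    note y1c = comp_hom[OF c(2) y1] and y2c = comp_hom[OF c(2) y2] and y3c = comp_hom[OF c(2) y3]
    have "(y2 \<cdot> c, y3 \<cdot> c) \<in> gpairs C Y ?I" using gpairs_precomp[OF rI y23 y2 c(2)] .
    then obtain V d x2' x3 where d: "regular_epi C d" "d \<in> Hom C V U" and x23: "(x2', x3) \<in> gpairs C X S"
      and fx2': "f \<cdot> x2' = (y2 \<cdot> c) \<cdot> d" and fx3: "f \<cdot> x3 = (y3 \<cdot> c) \<cdot> d"
      using gpairs_rel_image(2)[OF f(2) rS y2c y3c] by blast
    note y1d = comp_hom[OF d(2) y1c] and y3d = comp_hom[OF d(2) y3c]
    (* A priori the lifts have their own stage; their images under f show that it is the given one. *)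
    have dom_eq: "A = B" if "x \<in> Hom C A X" "f \<cdot> x \<in> Hom C B Y" for x A B
      using comp_hom[OF that(1) f(2)] that(2) by (auto simp: Hom_def)
    obtain A where "x1 \<in> Hom C A X" "x2 \<in> Hom C A X" using gpairsE[OF x12 rS] by blast
    moreover from this have "A = U" using dom_eq[of x1 A U] fx1 y1c by simp
    ultimately have x1: "x1 \<in> Hom C U X" and x2: "x2 \<in> Hom C U X" by simp_all
    obtain B where "x2' \<in> Hom C B X" "x3 \<in> Hom C B X" using gpairsE[OF x23 rS] by blast
    moreover from this have "B = V" using dom_eq[of x3 B V] fx3 y3d by simp
    ultimately have x2': "x2' \<in> Hom C V X" and x3: "x3 \<in> Hom C V X" by simp_all
    note x1d = comp_hom[OF d(2) x1] and x2d = comp_hom[OF d(2) x2]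
    have x12d: "(x1 \<cdot> d, x2 \<cdot> d) \<in> gpairs C X S" using gpairs_precomp[OF rS x12 x1 d(2)] .
    have x22': "(x2 \<cdot> d, x2') \<in> gpairs C X ?K"
      using K(2)[OF x2d x2'] comp_assoc[OF d(2) x2 f(2)] fx2 fx2' by simp
    obtain W e a b where e: "regular_epi C e" "e \<in> Hom C W V"
      and a: "((x1 \<cdot> d) \<cdot> e, a) \<in> gpairs C X ?K" and ab: "(a, b) \<in> gpairs C X S"
      and b: "(b, x3 \<cdot> e) \<in> gpairs C X ?K"
      using goursat_exchange[OF K(1) S x1d x12d x22' x23] .
    note x1e = comp_hom[OF e(2) x1d] and x3e = comp_hom[OF e(2) x3]
    have ah: "a \<in> Hom C W X" using gpairs_hom2[OF a rK x1e] .
    have bh: "b \<in> Hom C W X" using gpairs_hom1[OF b rK x3e] .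
    have "f \<cdot> a = ((y1 \<cdot> c) \<cdot> d) \<cdot> e"
      using K(2)[OF x1e ah] a comp_assoc[OF e(2) x1d f(2)] comp_assoc[OF d(2) x1 f(2)] fx1 by simp
    moreover have "f \<cdot> b = ((y3 \<cdot> c) \<cdot> d) \<cdot> e"
      using K(2)[OF bh x3e] b comp_assoc[OF e(2) x3 f(2)] fx3 by simp
    ultimately have "(((y1 \<cdot> c) \<cdot> d) \<cdot> e, ((y3 \<cdot> c) \<cdot> d) \<cdot> e) \<in> gpairs C Y ?I"
      using rel_image_memI[OF f(2) rS ab] by simp
    then show "(y1, y3) \<in> gpairs C Y ?I"
      using gpairs_local[OF rI y1d y3d e] gpairs_local[OF rI y1c y3c d] gpairs_local[OF rI y1 y3 c] by blast
  qed
qed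

text \<open>The inverse image of \<open>f(S)\<close> along \<open>f\<close>, obtained as the kernel pair of \<open>X \<rightarrow> Y \<rightarrow> Y/f(S)\<close>.\<close>

definition saturation where
  "saturation Y f S = kernel_relation C (quotient_map C Y (rel_image C f S) \<cdot> f)"

text \<open>The saturation is the join of \<open>S\<close> and the kernel pair \<open>K\<close> of \<open>f\<close>: an element of it is locally a
  chain of the form \<open>K \<circ> S \<circ> K\<close>, and such a chain lies in every equivalence relation above both.\<close>

lemma saturation_least:
  assumes f: "regular_epi C f" "f \<in> Hom C X Y" and S: "equivalence_relation C X S"
  defines "J \<equiv> saturation Y f S"
  shows "equivalence_relation C X J"
    "\<lbrakk>x \<in> Hom C T X; x' \<in> Hom C T X\<rbrakk> \<Longrightarrow>
      (x, x') \<in> gpairs C X J \<longleftrightarrow> (f \<cdot> x, f \<cdot> x') \<in> gpairs C Y (rel_image C f S)"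
    "gpairs C X (kernel_relation C f) \<subseteq> gpairs C X J" "gpairs C X S \<subseteq> gpairs C X J"
    "\<lbrakk>equivalence_relation C X W; gpairs C X (kernel_relation C f) \<subseteq> gpairs C X W;
        gpairs C X S \<subseteq> gpairs C X W\<rbrakk> \<Longrightarrow> gpairs C X J \<subseteq> gpairs C X W"
proof -
  let ?I = "rel_image C f S" and ?K = "kernel_relation C f"
  note rS = equivalence_relationD(1)[OF S]
  note I = equivalence_relation_image[OF f S]
  note K = kernel_relation_props[OF f(2)]
  note rK = equivalence_relationD(1)[OF K(1)]
  let ?q = "quotient_map C Y ?I"
  define Z where "Z = Cod C ?q"
  note q = quotient_map_props[OF I, folded Z_def]
  have J_eq: "J = kernel_relation C (?q \<cdot> f)" by (simp add: J_def saturation_def)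
  note J = kernel_relation_props[OF comp_hom[OF f(2) q(1)], folded J_eq]
  note rJ = equivalence_relationD(1)[OF J(1)]
  have mem: "(x, x') \<in> gpairs C X J \<longleftrightarrow> (f \<cdot> x, f \<cdot> x') \<in> gpairs C Y ?I"
    if x: "x \<in> Hom C T X" and x': "x' \<in> Hom C T X" for T x x'
    using J(2)[OF x x'] q(3)[OF comp_hom[OF x f(2)] comp_hom[OF x' f(2)]]
      comp_assoc[OF x f(2) q(1)] comp_assoc[OF x' f(2) q(1)] by simp
  show "equivalence_relation C X J" by (rule J(1))
  show "\<lbrakk>x \<in> Hom C T X; x' \<in> Hom C T X\<rbrakk> \<Longrightarrow>
      (x, x') \<in> gpairs C X J \<longleftrightarrow> (f \<cdot> x, f \<cdot> x') \<in> gpairs C Y ?I" by (rule mem)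
  show "gpairs C X ?K \<subseteq> gpairs C X J"
  proof (rule subrelI)
    fix x x' assume xx: "(x, x') \<in> gpairs C X ?K"
    obtain T where x: "x \<in> Hom C T X" "x' \<in> Hom C T X" using gpairsE[OF xx rK] by blast
    show "(x, x') \<in> gpairs C X J"
      using xx mem[OF x] K(2)[OF x] equivalence_relationD(3)[OF I comp_hom[OF x(2) f(2)]] by simp
  qed
  show "gpairs C X S \<subseteq> gpairs C X J"
  proof (rule subrelI)
    fix x x' assume xx: "(x, x') \<in> gpairs C X S"
    obtain T where x: "x \<in> Hom C T X" "x' \<in> Hom C T X" using gpairsE[OF xx rS] by blast
    show "(x, x') \<in> gpairs C X J" using mem[OF x] rel_image_memI[OF f(2) rS xx] by simp
  qed
  assume W: "equivalence_relation C X W" and KW: "gpairs C X ?K \<subseteq> gpairs C X W" and SW: "gpairs C X S \<subseteq> gpairs C X W"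
  show "gpairs C X J \<subseteq> gpairs C X W"
  proof (rule subrelI)
    fix x x' assume xx: "(x, x') \<in> gpairs C X J"
    obtain T where x: "x \<in> Hom C T X" and x': "x' \<in> Hom C T X" using gpairsE[OF xx rJ] by blast
    note fx = comp_hom[OF x f(2)] and fx' = comp_hom[OF x' f(2)]
    obtain U c a b where c: "regular_epi C c" "c \<in> Hom C U T" and ab: "(a, b) \<in> gpairs C X S"
      and fa: "f \<cdot> a = (f \<cdot> x) \<cdot> c" and fb: "f \<cdot> b = (f \<cdot> x') \<cdot> c"
      using xx mem[OF x x'] gpairs_rel_image(2)[OF f(2) rS fx fx'] by blast
    note xc = comp_hom[OF c(2) x] and xc' = comp_hom[OF c(2) x']
    obtain V where abV: "a \<in> Hom C V X" "b \<in> Hom C V X" using gpairsE[OF ab rS] by blast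
    have "V = U" using comp_hom[OF abV(1) f(2)] comp_hom[OF c(2) fx] fa by (auto simp: Hom_def)
    then have a: "a \<in> Hom C U X" and b: "b \<in> Hom C U X" using abV by auto
    have "(x \<cdot> c, a) \<in> gpairs C X ?K" "(b, x' \<cdot> c) \<in> gpairs C X ?K"
      using K(2)[OF xc a] K(2)[OF b xc'] fa fb comp_assoc[OF c(2) x f(2)] comp_assoc[OF c(2) x' f(2)] by auto
    then have "(x \<cdot> c, x' \<cdot> c) \<in> gpairs C X W"
      using ab KW SW equivalence_relationD(5)[OF W] by blast
    then show "(x, x') \<in> gpairs C X W"
      using gpairs_local[OF equivalence_relationD(1)[OF W] x x' c] by blast
  qed
qed

abbreviation Eq where
  "Eq X \<equiv> eqrel_lattice C X"

lemma eqrel_lattice_le_iff: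
  "\<lbrakk>equivalence_relation C X R; equivalence_relation C X S\<rbrakk> \<Longrightarrow>
    R \<sqsubseteq>\<^bsub>Eq X\<^esub> S \<longleftrightarrow> gpairs C X R \<subseteq> gpairs C X S"
  using subobj_le_iff_gpairs equivalence_relationD(1) by (simp add: eqrel_lattice_def)

lemma eqrel_lattice_eq_iff:
  "\<lbrakk>equivalence_relation C X R; equivalence_relation C X S\<rbrakk> \<Longrightarrow>
    R .=\<^bsub>Eq X\<^esub> S \<longleftrightarrow> gpairs C X R = gpairs C X S"
  using subobj_eq_iff_gpairs equivalence_relationD(1) by (simp add: eqrel_lattice_def)

lemma eqrel_lattice_carrier: "R \<in> carrier (Eq X) \<longleftrightarrow> equivalence_relation C X R"
  by (simp add: eqrel_lattice_def)

text \<open>By exactness \<open>R\<close> is the kernel pair of its quotient, so the saturation of \<open>S\<close> along that quotient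
  is a join of \<open>R\<close> and \<open>S\<close>.\<close>

lemma weak_lattice_eqrel_lattice: "weak_lattice (Eq X)"
proof
  fix R S assume RS: "R \<in> carrier (Eq X)" "S \<in> carrier (Eq X)"
  then have R: "equivalence_relation C X R" and S: "equivalence_relation C X S"
    by (simp_all add: eqrel_lattice_carrier)
  let ?q = "quotient_map C X R"
  define Z where "Z = Cod C ?q"
  note q = quotient_map_props[OF R, folded Z_def]
  note K = kernel_relation_props[OF q(1)]
  have KR: "gpairs C X (kernel_relation C ?q) = gpairs C X R"
    by (rule gpairs_eqI[OF equivalence_relationD(1)[OF K(1)] equivalence_relationD(1)[OF R]])
      (simp add: K(2) q(3))
  define J where "J = saturation Z ?q S"
  note J = saturation_least[OF q(2,1) S, folded J_def, unfolded KR]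
  have "W \<in> Upper (Eq X) {R, S} \<longleftrightarrow> W \<in> carrier (Eq X) \<and> R \<sqsubseteq>\<^bsub>Eq X\<^esub> W \<and> S \<sqsubseteq>\<^bsub>Eq X\<^esub> W" for W
    using RS unfolding Upper_def by blast
  then have up: "W \<in> Upper (Eq X) {R, S} \<longleftrightarrow> equivalence_relation C X W \<and>
      gpairs C X R \<subseteq> gpairs C X W \<and> gpairs C X S \<subseteq> gpairs C X W" for W
    using eqrel_lattice_le_iff[OF R] eqrel_lattice_le_iff[OF S] unfolding eqrel_lattice_carrier by metis
  have "J \<sqsubseteq>\<^bsub>Eq X\<^esub> W" if "W \<in> Upper (Eq X) {R, S}" for W
  proof -
    have W: "equivalence_relation C X W" "gpairs C X R \<subseteq> gpairs C X W" "gpairs C X S \<subseteq> gpairs C X W"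
      using that[unfolded up] by simp_all
    show ?thesis unfolding eqrel_lattice_le_iff[OF J(1) W(1)] by (rule J(5)[OF W])
  qed
  moreover have "J \<in> Upper (Eq X) {R, S}" unfolding up using J(1,3,4) by simp
  moreover have "Upper (Eq X) {R, S} \<subseteq> carrier (Eq X)" by (rule Upper_closed)
  ultimately have "least (Eq X) J (Upper (Eq X) {R, S})" unfolding least_def by blast
  then show "\<exists>s. least (Eq X) s (Upper (Eq X) {R, S})" by blast
  obtain M where M: "equivalence_relation C X M" "gpairs C X M = gpairs C X R \<inter> gpairs C X S"
    using intersection_exists[OF R S] by blast
  have "W \<in> Lower (Eq X) {R, S} \<longleftrightarrow> W \<in> carrier (Eq X) \<and> W \<sqsubseteq>\<^bsub>Eq X\<^esub> R \<and> W \<sqsubseteq>\<^bsub>Eq X\<^esub> S" for W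
    using RS unfolding Lower_def by blast
  then have low: "W \<in> Lower (Eq X) {R, S} \<longleftrightarrow> equivalence_relation C X W \<and>
      gpairs C X W \<subseteq> gpairs C X R \<and> gpairs C X W \<subseteq> gpairs C X S" for W
    using eqrel_lattice_le_iff[OF _ R] eqrel_lattice_le_iff[OF _ S] unfolding eqrel_lattice_carrier by metis
  have "W \<sqsubseteq>\<^bsub>Eq X\<^esub> M" if "W \<in> Lower (Eq X) {R, S}" for W
  proof -
    have W: "equivalence_relation C X W" "gpairs C X W \<subseteq> gpairs C X R" "gpairs C X W \<subseteq> gpairs C X S"
      using that[unfolded low] by simp_all
    show ?thesis unfolding eqrel_lattice_le_iff[OF W(1) M(1)] M(2) using W(2,3) by (rule Int_greatest)
  qed
  moreover have "M \<in> Lower (Eq X) {R, S}" unfolding low M(2) using M(1) by simp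
  moreover have "Lower (Eq X) {R, S} \<subseteq> carrier (Eq X)" by (rule Lower_closed)
  ultimately have "greatest (Eq X) M (Lower (Eq X) {R, S})" unfolding greatest_def by blast
  then show "\<exists>s. greatest (Eq X) s (Lower (Eq X) {R, S})" by blast
next
  fix R S T assume "R \<in> carrier (Eq X)" "S \<in> carrier (Eq X)" "T \<in> carrier (Eq X)"
  then have R: "equivalence_relation C X R" and S: "equivalence_relation C X S" and T: "equivalence_relation C X T"
    by (simp_all add: eqrel_lattice_carrier)
  note eq = eqrel_lattice_eq_iff and le = eqrel_lattice_le_iff
  show "R .=\<^bsub>Eq X\<^esub> S \<Longrightarrow> S .=\<^bsub>Eq X\<^esub> T \<Longrightarrow> R .=\<^bsub>Eq X\<^esub> T"
    unfolding eq[OF R S] eq[OF S T] eq[OF R T] by (rule trans)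
  show "R \<sqsubseteq>\<^bsub>Eq X\<^esub> S \<Longrightarrow> S \<sqsubseteq>\<^bsub>Eq X\<^esub> T \<Longrightarrow> R \<sqsubseteq>\<^bsub>Eq X\<^esub> T"
    unfolding le[OF R S] le[OF S T] le[OF R T] by (rule subset_trans)
next
  fix R S assume "R \<in> carrier (Eq X)" "S \<in> carrier (Eq X)"
  then have R: "equivalence_relation C X R" and S: "equivalence_relation C X S"
    by (simp_all add: eqrel_lattice_carrier)
  note eq = eqrel_lattice_eq_iff and le = eqrel_lattice_le_iff
  show "R .=\<^bsub>Eq X\<^esub> R" "R \<sqsubseteq>\<^bsub>Eq X\<^esub> R" unfolding eq[OF R R] le[OF R R] by blast+
  show "R .=\<^bsub>Eq X\<^esub> S \<Longrightarrow> S .=\<^bsub>Eq X\<^esub> R" unfolding eq[OF R S] eq[OF S R] by (rule sym)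
  show "R \<sqsubseteq>\<^bsub>Eq X\<^esub> S \<Longrightarrow> S \<sqsubseteq>\<^bsub>Eq X\<^esub> R \<Longrightarrow> R .=\<^bsub>Eq X\<^esub> S"
    unfolding le[OF R S] le[OF S R] eq[OF R S] by (rule subset_antisym)
next
  fix R S T U assume RS: "R .=\<^bsub>Eq X\<^esub> S" and TU: "T .=\<^bsub>Eq X\<^esub> U"
    and "R \<in> carrier (Eq X)" "S \<in> carrier (Eq X)" "T \<in> carrier (Eq X)" "U \<in> carrier (Eq X)"
  then have R: "equivalence_relation C X R" and S: "equivalence_relation C X S"
    and T: "equivalence_relation C X T" and U: "equivalence_relation C X U"
    by (simp_all add: eqrel_lattice_carrier)
  show "R \<sqsubseteq>\<^bsub>Eq X\<^esub> T \<longleftrightarrow> S \<sqsubseteq>\<^bsub>Eq X\<^esub> U"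
    using RS TU
    unfolding eqrel_lattice_eq_iff[OF R S] eqrel_lattice_eq_iff[OF T U]
      eqrel_lattice_le_iff[OF R T] eqrel_lattice_le_iff[OF S U] by simp
qed

lemma eqrel_join:
  assumes R: "equivalence_relation C X R" and S: "equivalence_relation C X S"
  shows "equivalence_relation C X (R \<squnion>\<^bsub>Eq X\<^esub> S)"
    "gpairs C X R \<subseteq> gpairs C X (R \<squnion>\<^bsub>Eq X\<^esub> S)" "gpairs C X S \<subseteq> gpairs C X (R \<squnion>\<^bsub>Eq X\<^esub> S)"
    "\<lbrakk>equivalence_relation C X W; gpairs C X R \<subseteq> gpairs C X W; gpairs C X S \<subseteq> gpairs C X W\<rbrakk>
      \<Longrightarrow> gpairs C X (R \<squnion>\<^bsub>Eq X\<^esub> S) \<subseteq> gpairs C X W"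
proof -
  interpret L: weak_lattice "Eq X" by (rule weak_lattice_eqrel_lattice)
  have c: "R \<in> carrier (Eq X)" "S \<in> carrier (Eq X)" using R S by (auto simp: eqrel_lattice_carrier)
  show J: "equivalence_relation C X (R \<squnion>\<^bsub>Eq X\<^esub> S)" using L.join_closed[OF c] eqrel_lattice_carrier by blast
  show "gpairs C X R \<subseteq> gpairs C X (R \<squnion>\<^bsub>Eq X\<^esub> S)" "gpairs C X S \<subseteq> gpairs C X (R \<squnion>\<^bsub>Eq X\<^esub> S)"
    using L.join_left[OF c] L.join_right[OF c] eqrel_lattice_le_iff[OF R J] eqrel_lattice_le_iff[OF S J] by auto
  assume W: "equivalence_relation C X W" "gpairs C X R \<subseteq> gpairs C X W" "gpairs C X S \<subseteq> gpairs C X W"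
  then show "gpairs C X (R \<squnion>\<^bsub>Eq X\<^esub> S) \<subseteq> gpairs C X W"
    using L.join_le[of R W S] c eqrel_lattice_le_iff[OF R W(1)] eqrel_lattice_le_iff[OF S W(1)]
      eqrel_lattice_le_iff[OF J W(1)] by (simp add: eqrel_lattice_carrier)
qed

lemma eqrel_meet:
  assumes R: "equivalence_relation C X R" and S: "equivalence_relation C X S"
  shows "equivalence_relation C X (R \<sqinter>\<^bsub>Eq X\<^esub> S)"
    "gpairs C X (R \<sqinter>\<^bsub>Eq X\<^esub> S) = gpairs C X R \<inter> gpairs C X S"
proof -
  interpret L: weak_lattice "Eq X" by (rule weak_lattice_eqrel_lattice)
  have c: "R \<in> carrier (Eq X)" "S \<in> carrier (Eq X)" using R S by (auto simp: eqrel_lattice_carrier)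
  show M: "equivalence_relation C X (R \<sqinter>\<^bsub>Eq X\<^esub> S)" using L.meet_closed[OF c] eqrel_lattice_carrier by blast
  obtain N where N: "equivalence_relation C X N" "gpairs C X N = gpairs C X R \<inter> gpairs C X S"
    using intersection_exists[OF R S] by blast
  have "N \<in> carrier (Eq X)" using N(1) by (simp add: eqrel_lattice_carrier)
  moreover have "N \<sqsubseteq>\<^bsub>Eq X\<^esub> R" "N \<sqsubseteq>\<^bsub>Eq X\<^esub> S"
    unfolding eqrel_lattice_le_iff[OF N(1) R] eqrel_lattice_le_iff[OF N(1) S] N(2) by (rule Int_lower1 Int_lower2)+
  ultimately have "N \<sqsubseteq>\<^bsub>Eq X\<^esub> R \<sqinter>\<^bsub>Eq X\<^esub> S" by (intro L.meet_le c)
  moreover have "gpairs C X (R \<sqinter>\<^bsub>Eq X\<^esub> S) \<subseteq> gpairs C X R" "gpairs C X (R \<sqinter>\<^bsub>Eq X\<^esub> S) \<subseteq> gpairs C X S"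
    using L.meet_left[OF c] L.meet_right[OF c] unfolding eqrel_lattice_le_iff[OF M R] eqrel_lattice_le_iff[OF M S] .
  ultimately show "gpairs C X (R \<sqinter>\<^bsub>Eq X\<^esub> S) = gpairs C X R \<inter> gpairs C X S"
    unfolding eqrel_lattice_le_iff[OF N(1) M] N(2) by blast
qed

lemma eqrel_join_mono:
  assumes "equivalence_relation C X R" "equivalence_relation C X S"
    "equivalence_relation C X R'" "equivalence_relation C X S'"
    "gpairs C X R \<subseteq> gpairs C X R'" "gpairs C X S \<subseteq> gpairs C X S'"
  shows "gpairs C X (R \<squnion>\<^bsub>Eq X\<^esub> S) \<subseteq> gpairs C X (R' \<squnion>\<^bsub>Eq X\<^esub> S')"
  using eqrel_join(4)[OF assms(1,2) eqrel_join(1)[OF assms(3,4)]] assms(5,6) eqrel_join(2,3)[OF assms(3,4)]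
  by (simp add: subset_trans)

lemma gpairs_image_iff_join:
  assumes f: "regular_epi C f" "f \<in> Hom C X Y" and S: "equivalence_relation C X S"
    and x: "x \<in> Hom C T X" "x' \<in> Hom C T X"
  shows "(f \<cdot> x, f \<cdot> x') \<in> gpairs C Y (rel_image C f S) \<longleftrightarrow>
    (x, x') \<in> gpairs C X (kernel_relation C f \<squnion>\<^bsub>Eq X\<^esub> S)"
proof -
  let ?K = "kernel_relation C f"
  have K: "equivalence_relation C X ?K" using kernel_relation_props[OF f(2)] by blast
  define J where "J = saturation Y f S"
  note J = saturation_least[OF f S, folded J_def]
  have "gpairs C X J = gpairs C X (?K \<squnion>\<^bsub>Eq X\<^esub> S)"
    using J(5)[OF eqrel_join(1-3)[OF K S]] eqrel_join(4)[OF K S J(1,3,4)] by blast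
  then show ?thesis using J(2)[OF x] by simp
qed

text \<open>The usual equivalence of the two distributive laws, with the dual one reduced to its nontrivial
  inclusion.\<close>

lemma weak_distributive_lattice_iff:
  "weak_distributive_lattice (Eq X) \<longleftrightarrow>
    (\<forall>R S T. equivalence_relation C X R \<and> equivalence_relation C X S \<and> equivalence_relation C X T \<longrightarrow>
      gpairs C X (T \<squnion>\<^bsub>Eq X\<^esub> R) \<inter> gpairs C X (T \<squnion>\<^bsub>Eq X\<^esub> S) \<subseteq> gpairs C X (T \<squnion>\<^bsub>Eq X\<^esub> (R \<sqinter>\<^bsub>Eq X\<^esub> S)))"
  (is "_ \<longleftrightarrow> ?dual")
proof
  assume "weak_distributive_lattice (Eq X)"
  then interpret D: weak_distributive_lattice "Eq X" .
  have D: "gpairs C X A \<inter> gpairs C X (B \<squnion>\<^bsub>Eq X\<^esub> E) = gpairs C X ((A \<sqinter>\<^bsub>Eq X\<^esub> B) \<squnion>\<^bsub>Eq X\<^esub> (A \<sqinter>\<^bsub>Eq X\<^esub> E))"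
    if A: "equivalence_relation C X A" and B: "equivalence_relation C X B" and E: "equivalence_relation C X E" for A B E
    using D.meet_join_distrib[of A B E] that eqrel_meet[OF A eqrel_join(1)[OF B E]]
      eqrel_join(1)[OF eqrel_meet(1)[OF A B] eqrel_meet(1)[OF A E]]
    by (simp add: eqrel_lattice_carrier eqrel_lattice_eq_iff)
  show ?dual
  proof (intro allI impI, elim conjE)
    fix R S T assume R: "equivalence_relation C X R" and S: "equivalence_relation C X S" and T: "equivalence_relation C X T"
    note TR = eqrel_join[OF T R] and RS = eqrel_meet[OF R S]
    note SR = eqrel_meet[OF S R]
    note m1 = eqrel_meet[OF TR(1) T] and m2 = eqrel_meet[OF TR(1) S]
    note J = eqrel_join[OF T RS(1)]
    have "gpairs C X S \<inter> gpairs C X (T \<squnion>\<^bsub>Eq X\<^esub> R) \<subseteq> gpairs C X (T \<squnion>\<^bsub>Eq X\<^esub> (R \<sqinter>\<^bsub>Eq X\<^esub> S))"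
      unfolding D[OF S T R]
      using eqrel_join(4)[OF eqrel_meet(1)[OF S T] SR(1) J(1)] J(2,3) eqrel_meet(2)[OF S T] SR(2) RS(2) by blast
    then show "gpairs C X (T \<squnion>\<^bsub>Eq X\<^esub> R) \<inter> gpairs C X (T \<squnion>\<^bsub>Eq X\<^esub> S) \<subseteq> gpairs C X (T \<squnion>\<^bsub>Eq X\<^esub> (R \<sqinter>\<^bsub>Eq X\<^esub> S))"
      unfolding D[OF TR(1) T S]
      using eqrel_join(4)[OF m1(1) m2(1) J(1)] m1(2) m2(2) J(2) by blast
  qed
next
  assume dual: ?dual
  interpret L: weak_lattice "Eq X" by (rule weak_lattice_eqrel_lattice)
  show "weak_distributive_lattice (Eq X)"
  proof
    fix R S T assume "R \<in> carrier (Eq X)" "S \<in> carrier (Eq X)" "T \<in> carrier (Eq X)"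
    then have R: "equivalence_relation C X R" and S: "equivalence_relation C X S" and T: "equivalence_relation C X T"
      by (simp_all add: eqrel_lattice_carrier)
    note ST = eqrel_join[OF S T] and RS = eqrel_meet[OF R S] and RT = eqrel_meet[OF R T]
    note lhs = eqrel_meet[OF R ST(1)] and rhs = eqrel_join[OF RS(1) RT(1)]
    have "gpairs C X (S \<squnion>\<^bsub>Eq X\<^esub> T) \<subseteq> gpairs C X (T \<squnion>\<^bsub>Eq X\<^esub> S)"
      using ST(4)[OF eqrel_join(1)[OF T S]] eqrel_join(2,3)[OF T S] by blast
    then have "gpairs C X (R \<sqinter>\<^bsub>Eq X\<^esub> (S \<squnion>\<^bsub>Eq X\<^esub> T)) \<subseteq> gpairs C X (T \<squnion>\<^bsub>Eq X\<^esub> (R \<sqinter>\<^bsub>Eq X\<^esub> S))"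
      using dual R S T lhs(2) eqrel_join(3)[OF T R] by blast
    also have "\<dots> \<subseteq> gpairs C X ((R \<sqinter>\<^bsub>Eq X\<^esub> S) \<squnion>\<^bsub>Eq X\<^esub> T)"
      using eqrel_join(4)[OF T RS(1) eqrel_join(1)[OF RS(1) T]] eqrel_join(2,3)[OF RS(1) T] by blast
    (* The dual law is applied a second time, with \<open>R \<sqinter> S\<close> as the fixed joinand. *)
    finally have "gpairs C X (R \<sqinter>\<^bsub>Eq X\<^esub> (S \<squnion>\<^bsub>Eq X\<^esub> T)) \<subseteq>
        gpairs C X ((R \<sqinter>\<^bsub>Eq X\<^esub> S) \<squnion>\<^bsub>Eq X\<^esub> R) \<inter> gpairs C X ((R \<sqinter>\<^bsub>Eq X\<^esub> S) \<squnion>\<^bsub>Eq X\<^esub> T)"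
      using lhs(2) eqrel_join(3)[OF RS(1) R] by blast
    also have "\<dots> \<subseteq> gpairs C X ((R \<sqinter>\<^bsub>Eq X\<^esub> S) \<squnion>\<^bsub>Eq X\<^esub> (R \<sqinter>\<^bsub>Eq X\<^esub> T))"
      using dual R T RS(1) by blast
    finally have le: "gpairs C X (R \<sqinter>\<^bsub>Eq X\<^esub> (S \<squnion>\<^bsub>Eq X\<^esub> T)) \<subseteq> gpairs C X ((R \<sqinter>\<^bsub>Eq X\<^esub> S) \<squnion>\<^bsub>Eq X\<^esub> (R \<sqinter>\<^bsub>Eq X\<^esub> T))" .
    have "gpairs C X ((R \<sqinter>\<^bsub>Eq X\<^esub> S) \<squnion>\<^bsub>Eq X\<^esub> (R \<sqinter>\<^bsub>Eq X\<^esub> T)) \<subseteq> gpairs C X (R \<sqinter>\<^bsub>Eq X\<^esub> (S \<squnion>\<^bsub>Eq X\<^esub> T))"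
      using rhs(4)[OF lhs(1)] lhs(2) RS(2) RT(2) ST(2,3) by blast
    with le show "R \<sqinter>\<^bsub>Eq X\<^esub> (S \<squnion>\<^bsub>Eq X\<^esub> T) .=\<^bsub>Eq X\<^esub> (R \<sqinter>\<^bsub>Eq X\<^esub> S) \<squnion>\<^bsub>Eq X\<^esub> (R \<sqinter>\<^bsub>Eq X\<^esub> T)"
      using eqrel_lattice_eq_iff[OF lhs(1) rhs(1)] by blast
  qed
qed

end

section \<open>Closure operators of Birkhoff subcategories\<close>

text \<open>The universal property with the inclusion functor and the full subcategory unfolded.\<close>

lemma (in epireflective_subcategory) reflection_props:
  assumes A: "A \<in> Obj C"
  shows "\<eta> A \<in> Hom C A (Lo A)" "Lo A \<in> L" "regular_epi C (\<eta> A)"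
    "\<lbrakk>B \<in> L; h \<in> Hom C A B\<rbrakk> \<Longrightarrow> \<exists>g \<in> Hom C (Lo A) B. g \<cdot> \<eta> A = h"
proof -
  interpret adj: adjunction C "full_subcategory C L" Lo La "\<lambda>A. A" "\<lambda>f. f" \<eta> by (rule reflective)
  show "\<eta> A \<in> Hom C A (Lo A)" using adj.unit_hom[OF A] .
  show "Lo A \<in> L" using adj.F.map_obj[OF A] by (simp add: full_subcategory_def)
  show "regular_epi C (\<eta> A)" using unit_regular_epi[OF A] .
  assume "B \<in> L" "h \<in> Hom C A B"
  then show "\<exists>g \<in> Hom C (Lo A) B. g \<cdot> \<eta> A = h"
    using adj.unit_universal[OF A, of B h] by (auto simp: full_subcategory_def Hom_def)
qed

context exact_goursat_category
begin

text \<open>Let \<open>W\<close> be the image of the kernel pair of \<open>\<eta>\<^sub>X\<close>. Since \<open>\<eta>\<^sub>Z \<cdot> h\<close> factors through \<open>\<eta>\<^sub>X\<close>, elements of \<open>W\<close>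
  are identified by \<open>\<eta>\<^sub>Z\<close>. Conversely \<open>X \<rightarrow> Z \<rightarrow> Z/W\<close> factors through \<open>\<eta>\<^sub>X\<close>, so \<open>Z/W\<close> is a regular
  quotient of the reflection of \<open>X\<close> and thus belongs to the Birkhoff subcategory. Hence \<open>Z \<rightarrow> Z/W\<close>
  factors through \<open>\<eta>\<^sub>Z\<close>, and \<open>\<eta>\<^sub>Z\<close> identifies no more than \<open>W\<close> does.\<close>

lemma birkhoff_unit_kernel_image:
  assumes birk: "birkhoff_subcategory C L Lo La \<eta>"
    and h: "regular_epi C h" "h \<in> Hom C X Z"
    and z: "z \<in> Hom C T Z" "z' \<in> Hom C T Z"
  shows "\<eta> Z \<cdot> z = \<eta> Z \<cdot> z' \<longleftrightarrow> (z, z') \<in> gpairs C Z (rel_image C h (kernel_relation C (\<eta> X)))"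
proof -
  interpret B: birkhoff_subcategory C L Lo La \<eta> by (rule birk)
  have X: "X \<in> Obj C" and Z: "Z \<in> Obj C" using HomD[OF h(2)] by auto
  note \<eta>X = B.reflection_props[OF X] and \<eta>Z = B.reflection_props[OF Z]
  let ?N = "kernel_relation C (\<eta> X)"
  note N = kernel_relation_props[OF \<eta>X(1)]
  note rN = equivalence_relationD(1)[OF N(1)]
  let ?W = "rel_image C h ?N"
  note W = equivalence_relation_image[OF h N(1)]
  show ?thesis
  proof
    assume "(z, z') \<in> gpairs C Z ?W"
    then obtain U c x x' where c: "regular_epi C c" "c \<in> Hom C U T" and xx: "(x, x') \<in> gpairs C X ?N"
      and hx: "h \<cdot> x = z \<cdot> c" "h \<cdot> x' = z' \<cdot> c"
      using gpairs_rel_image(2)[OF h(2) rN z] by blast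
    obtain V where x: "x \<in> Hom C V X" "x' \<in> Hom C V X" using gpairsE[OF xx rN] by blast
    obtain g where g: "g \<in> Hom C (Lo X) (Lo Z)" "g \<cdot> \<eta> X = \<eta> Z \<cdot> h"
      using \<eta>X(4)[OF \<eta>Z(2) comp_hom[OF h(2) \<eta>Z(1)]] by blast
    have "\<eta> X \<cdot> x = \<eta> X \<cdot> x'" using xx N(2)[OF x] by simp
    then have "\<eta> Z \<cdot> (h \<cdot> x) = \<eta> Z \<cdot> (h \<cdot> x')"
      using comp_assoc[OF x(1) h(2) \<eta>Z(1)] comp_assoc[OF x(2) h(2) \<eta>Z(1)]
        comp_assoc[OF x(1) \<eta>X(1) g(1)] comp_assoc[OF x(2) \<eta>X(1) g(1)] g(2) by simp
    then have "(\<eta> Z \<cdot> z) \<cdot> c = (\<eta> Z \<cdot> z') \<cdot> c"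
      using hx comp_assoc[OF c(2) z(1) \<eta>Z(1)] comp_assoc[OF c(2) z(2) \<eta>Z(1)] by simp
    then show "\<eta> Z \<cdot> z = \<eta> Z \<cdot> z'"
      using regular_epi_cancel[OF c comp_hom[OF z(1) \<eta>Z(1)] comp_hom[OF z(2) \<eta>Z(1)]] by blast
  next
    assume eq: "\<eta> Z \<cdot> z = \<eta> Z \<cdot> z'"
    let ?p = "quotient_map C Z ?W"
    define Q where "Q = Cod C ?p"
    note p = quotient_map_props[OF W, folded Q_def]
    note ph = comp_hom[OF h(2) p(1)]
    have "(?p \<cdot> h) \<cdot> x = (?p \<cdot> h) \<cdot> x'"
      if x: "x \<in> Hom C V X" and x': "x' \<in> Hom C V X" and e: "\<eta> X \<cdot> x = \<eta> X \<cdot> x'" for V x x'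
      using p(3)[OF comp_hom[OF x h(2)] comp_hom[OF x' h(2)]] rel_image_memI[OF h(2) rN] N(2)[OF x x'] e
        comp_assoc[OF x h(2) p(1)] comp_assoc[OF x' h(2) p(1)] by simp
    then obtain k where k: "k \<in> Hom C (Lo X) Q" "k \<cdot> \<eta> X = ?p \<cdot> h"
      using regular_epi_factor[OF \<eta>X(3,1) ph] by blast
    have "regular_epi C k"
      using regular_epi_right_factor[OF _ \<eta>X(1) k(1)] regular_epi_comp[OF h p(2,1)] k(2) by simp
    then have "Q \<in> L" using B.quotient_closed[of k] HomD[OF k(1)] \<eta>X(2) by simp
    then obtain g where g: "g \<in> Hom C (Lo Z) Q" "g \<cdot> \<eta> Z = ?p" using \<eta>Z(4)[OF _ p(1)] by blast
    have "?p \<cdot> z = ?p \<cdot> z'"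
      using comp_assoc[OF z(1) \<eta>Z(1) g(1)] comp_assoc[OF z(2) \<eta>Z(1) g(1)] g(2) eq by simp
    then show "(z, z') \<in> gpairs C Z ?W" using p(3)[OF z] by simp
  qed
qed

text \<open>The kernel pair of \<open>h\<close> is represented by an arbitrary relation \<open>R\<close> with the same elements, so that
  the result applies directly both to the quotient by \<open>S\<close> and to the quotient by an image.\<close>

lemma birkhoff_unit_kernel_join:
  assumes birk: "birkhoff_subcategory C L Lo La \<eta>"
    and h: "regular_epi C h" "h \<in> Hom C X Z"
    and R: "equivalence_relation C X R"
    and RK: "\<And>T x x'. \<lbrakk>x \<in> Hom C T X; x' \<in> Hom C T X\<rbrakk> \<Longrightarrow> h \<cdot> x = h \<cdot> x' \<longleftrightarrow> (x, x') \<in> gpairs C X R"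
    and x: "x \<in> Hom C T X" "x' \<in> Hom C T X"
  shows "\<eta> Z \<cdot> (h \<cdot> x) = \<eta> Z \<cdot> (h \<cdot> x') \<longleftrightarrow> (x, x') \<in> gpairs C X (R \<squnion>\<^bsub>Eq X\<^esub> kernel_relation C (\<eta> X))"
proof -
  interpret B: birkhoff_subcategory C L Lo La \<eta> by (rule birk)
  have X: "X \<in> Obj C" using HomD[OF h(2)] by auto
  note N = kernel_relation_props[OF B.reflection_props(1)[OF X]]
  note K = kernel_relation_props[OF h(2)]
  have KR: "gpairs C X (kernel_relation C h) = gpairs C X R"
    by (rule gpairs_eqI[OF equivalence_relationD(1)[OF K(1)] equivalence_relationD(1)[OF R]])
      (simp add: K(2) RK)
  have "gpairs C X (kernel_relation C h \<squnion>\<^bsub>Eq X\<^esub> kernel_relation C (\<eta> X)) =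
      gpairs C X (R \<squnion>\<^bsub>Eq X\<^esub> kernel_relation C (\<eta> X))"
    using eqrel_join_mono[OF K(1) N(1) R N(1)] eqrel_join_mono[OF R N(1) K(1) N(1)] KR by blast
  then show ?thesis
    using birkhoff_unit_kernel_image[OF birk h comp_hom[OF x(1) h(2)] comp_hom[OF x(2) h(2)]]
      gpairs_image_iff_join[OF h N(1) x] by simp
qed

lemma closure_props:
  assumes epi: "epireflective_subcategory C L Lo La \<eta>" and S: "equivalence_relation C X S"
  defines "Z \<equiv> Cod C (quotient_map C X S)"
  shows "equivalence_relation C X (eqrel_closure C \<eta> X S)"
    "\<lbrakk>x \<in> Hom C T X; x' \<in> Hom C T X\<rbrakk> \<Longrightarrow> (x, x') \<in> gpairs C X (eqrel_closure C \<eta> X S) \<longleftrightarrow>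
      \<eta> Z \<cdot> (quotient_map C X S \<cdot> x) = \<eta> Z \<cdot> (quotient_map C X S \<cdot> x')"
proof -
  interpret B: epireflective_subcategory C L Lo La \<eta> by (rule epi)
  let ?q = "quotient_map C X S"
  note q = quotient_map_props[OF S, folded Z_def]
  have Z: "Z \<in> Obj C" "Cod C ?q = Z" using HomD[OF q(1)] by auto
  note \<eta>Z = B.reflection_props(1)[OF Z(1)]
  have cl: "eqrel_closure C \<eta> X S = kernel_relation C (\<eta> Z \<cdot> ?q)" using Z by (simp add: eqrel_closure_def)
  note K = kernel_relation_props[OF comp_hom[OF q(1) \<eta>Z], folded cl]
  show "equivalence_relation C X (eqrel_closure C \<eta> X S)" by (rule K(1))
  assume x: "x \<in> Hom C T X" "x' \<in> Hom C T X"
  show "(x, x') \<in> gpairs C X (eqrel_closure C \<eta> X S) \<longleftrightarrow> \<eta> Z \<cdot> (?q \<cdot> x) = \<eta> Z \<cdot> (?q \<cdot> x')"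
    using K(2)[OF x] comp_assoc[OF x(1) q(1) \<eta>Z] comp_assoc[OF x(2) q(1) \<eta>Z] by simp
qed

lemma birkhoff_closure_join:
  assumes birk: "birkhoff_subcategory C L Lo La \<eta>" and S: "equivalence_relation C X S"
  shows "gpairs C X (eqrel_closure C \<eta> X S) = gpairs C X (S \<squnion>\<^bsub>Eq X\<^esub> kernel_relation C (\<eta> X))"
proof -
  interpret B: birkhoff_subcategory C L Lo La \<eta> by (rule birk)
  let ?q = "quotient_map C X S"
  define Z where "Z = Cod C ?q"
  note q = quotient_map_props[OF S, folded Z_def]
  note c = closure_props[OF B.epireflective_subcategory_axioms S, folded Z_def]
  have X: "X \<in> Obj C" using HomD[OF q(1)] by auto
  have N: "equivalence_relation C X (kernel_relation C (\<eta> X))"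
    using kernel_relation_props(1)[OF B.reflection_props(1)[OF X]] .
  note J = eqrel_join(1)[OF S N]
  have "(x, x') \<in> gpairs C X (eqrel_closure C \<eta> X S) \<longleftrightarrow>
      (x, x') \<in> gpairs C X (S \<squnion>\<^bsub>Eq X\<^esub> kernel_relation C (\<eta> X))"
    if x: "x \<in> Hom C T X" "x' \<in> Hom C T X" for T x x'
    using c(2)[OF x] birkhoff_unit_kernel_join[OF birk q(2,1) S q(3) x] by simp
  then show ?thesis
    using gpairs_eqI[OF equivalence_relationD(1)[OF c(1)] equivalence_relationD(1)[OF J]] by blast
qed

text \<open>The composite \<open>X \<rightarrow> Y \<rightarrow> Y/f(S)\<close> is a regular epimorphism with kernel pair \<open>K \<or> S\<close>, where \<open>K\<close> is
  the kernel pair of \<open>f\<close>.\<close>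

lemma birkhoff_closure_image:
  assumes birk: "birkhoff_subcategory C L Lo La \<eta>"
    and f: "regular_epi C f" "f \<in> Hom C X Y" and S: "equivalence_relation C X S"
    and x: "x \<in> Hom C T X" "x' \<in> Hom C T X"
  shows "(f \<cdot> x, f \<cdot> x') \<in> gpairs C Y (eqrel_closure C \<eta> Y (rel_image C f S)) \<longleftrightarrow>
    (x, x') \<in> gpairs C X ((kernel_relation C f \<squnion>\<^bsub>Eq X\<^esub> S) \<squnion>\<^bsub>Eq X\<^esub> kernel_relation C (\<eta> X))"
proof -
  interpret B: birkhoff_subcategory C L Lo La \<eta> by (rule birk)
  let ?I = "rel_image C f S" and ?K = "kernel_relation C f"
  let ?q = "quotient_map C Y ?I"
  note I = equivalence_relation_image[OF f S]
  define Z where "Z = Cod C ?q"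
  note q = quotient_map_props[OF I, folded Z_def]
  note c = closure_props[OF B.epireflective_subcategory_axioms I, folded Z_def]
  have K: "equivalence_relation C X ?K" using kernel_relation_props(1)[OF f(2)] .
  have qf: "(?q \<cdot> f) \<cdot> a = (?q \<cdot> f) \<cdot> b \<longleftrightarrow> (a, b) \<in> gpairs C X (?K \<squnion>\<^bsub>Eq X\<^esub> S)"
    if a: "a \<in> Hom C U X" and b: "b \<in> Hom C U X" for U a b
    using q(3)[OF comp_hom[OF a f(2)] comp_hom[OF b f(2)]] gpairs_image_iff_join[OF f S a b]
      comp_assoc[OF a f(2) q(1)] comp_assoc[OF b f(2) q(1)] by simp
  show ?thesis
    using c(2)[OF comp_hom[OF x(1) f(2)] comp_hom[OF x(2) f(2)]]
      birkhoff_unit_kernel_join[OF birk regular_epi_comp[OF f q(2,1)] comp_hom[OF f(2) q(1)] eqrel_join(1)[OF K S] qf x]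
      comp_assoc[OF x(1) f(2) q(1)] comp_assoc[OF x(2) f(2) q(1)] by simp
qed

lemma distributive_imp_closure_preserves_meets:
  assumes dist: "weak_distributive_lattice (Eq X)" and birk: "birkhoff_subcategory C L Lo La \<eta>"
    and f: "regular_epi C f" "f \<in> Hom C X Y"
    and R: "equivalence_relation C X R" and S: "equivalence_relation C X S"
  shows "subobj_eq C (rel_image C f (eqrel_closure C \<eta> X (R \<sqinter>\<^bsub>Eq X\<^esub> S)))
    (eqrel_closure C \<eta> Y (rel_image C f R) \<sqinter>\<^bsub>Eq Y\<^esub> eqrel_closure C \<eta> Y (rel_image C f S))"
proof -
  interpret B: birkhoff_subcategory C L Lo La \<eta> by (rule birk)
  note epi = B.epireflective_subcategory_axioms
  have cl: "equivalence_relation C A (eqrel_closure C \<eta> A E)" if "equivalence_relation C A E" for A E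
    using closure_props(1)[OF epi that] .
  let ?K = "kernel_relation C f" and ?N = "kernel_relation C (\<eta> X)" and ?M = "R \<sqinter>\<^bsub>Eq X\<^esub> S"
  have X: "X \<in> Obj C" using HomD[OF f(2)] by simp
  have K: "equivalence_relation C X ?K" using kernel_relation_props(1)[OF f(2)] .
  have N: "equivalence_relation C X ?N" using kernel_relation_props(1)[OF B.reflection_props(1)[OF X]] .
  note M = eqrel_meet[OF R S] and T = eqrel_join[OF K N]
  note KR = eqrel_join[OF K R] and KS = eqrel_join[OF K S]
  note MN = eqrel_join[OF M(1) N]
  note KRN = eqrel_join[OF KR(1) N] and KSN = eqrel_join[OF KS(1) N] and KcM = eqrel_join[OF K cl[OF M(1)]]
  note TR = eqrel_join[OF T(1) R] and TS = eqrel_join[OF T(1) S] and TM = eqrel_join[OF T(1) M(1)]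
  note clM = birkhoff_closure_join[OF birk M(1)]
  (* Moving ?N inwards turns both joins into joins with the single relation ?K v ?N, to which the
     dual distributive law applies. *)
  have "gpairs C X ((?K \<squnion>\<^bsub>Eq X\<^esub> R) \<squnion>\<^bsub>Eq X\<^esub> ?N) \<subseteq> gpairs C X ((?K \<squnion>\<^bsub>Eq X\<^esub> ?N) \<squnion>\<^bsub>Eq X\<^esub> R)"
    using KRN(4)[OF TR(1) KR(4)[OF TR(1)]] T(2,3) TR(2,3) by blast
  moreover have "gpairs C X ((?K \<squnion>\<^bsub>Eq X\<^esub> S) \<squnion>\<^bsub>Eq X\<^esub> ?N) \<subseteq> gpairs C X ((?K \<squnion>\<^bsub>Eq X\<^esub> ?N) \<squnion>\<^bsub>Eq X\<^esub> S)"
    using KSN(4)[OF TS(1) KS(4)[OF TS(1)]] T(2,3) TS(2,3) by blast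
  moreover have "gpairs C X ((?K \<squnion>\<^bsub>Eq X\<^esub> ?N) \<squnion>\<^bsub>Eq X\<^esub> R) \<inter> gpairs C X ((?K \<squnion>\<^bsub>Eq X\<^esub> ?N) \<squnion>\<^bsub>Eq X\<^esub> S)
      \<subseteq> gpairs C X ((?K \<squnion>\<^bsub>Eq X\<^esub> ?N) \<squnion>\<^bsub>Eq X\<^esub> ?M)"
    using dist R S T(1) unfolding weak_distributive_lattice_iff by blast
  moreover have "gpairs C X ((?K \<squnion>\<^bsub>Eq X\<^esub> ?N) \<squnion>\<^bsub>Eq X\<^esub> ?M) \<subseteq> gpairs C X (?K \<squnion>\<^bsub>Eq X\<^esub> eqrel_closure C \<eta> X ?M)"
    using TM(4)[OF KcM(1) T(4)[OF KcM(1)]] KcM(2,3) MN(2,3) clM by blast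
  moreover have "gpairs C X (?K \<squnion>\<^bsub>Eq X\<^esub> eqrel_closure C \<eta> X ?M) \<subseteq> gpairs C X ((?K \<squnion>\<^bsub>Eq X\<^esub> R) \<squnion>\<^bsub>Eq X\<^esub> ?N)"
    using KcM(4)[OF KRN(1)] MN(4)[OF KRN(1)] clM KRN(2,3) KR(2,3) M(2) by blast
  moreover have "gpairs C X (?K \<squnion>\<^bsub>Eq X\<^esub> eqrel_closure C \<eta> X ?M) \<subseteq> gpairs C X ((?K \<squnion>\<^bsub>Eq X\<^esub> S) \<squnion>\<^bsub>Eq X\<^esub> ?N)"
    using KcM(4)[OF KSN(1)] MN(4)[OF KSN(1)] clM KSN(2,3) KS(2,3) M(2) by blast
  ultimately have key: "gpairs C X (?K \<squnion>\<^bsub>Eq X\<^esub> eqrel_closure C \<eta> X ?M) =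
      gpairs C X ((?K \<squnion>\<^bsub>Eq X\<^esub> R) \<squnion>\<^bsub>Eq X\<^esub> ?N) \<inter> gpairs C X ((?K \<squnion>\<^bsub>Eq X\<^esub> S) \<squnion>\<^bsub>Eq X\<^esub> ?N)" by blast
  let ?l = "rel_image C f (eqrel_closure C \<eta> X ?M)"
  let ?cR = "eqrel_closure C \<eta> Y (rel_image C f R)" and ?cS = "eqrel_closure C \<eta> Y (rel_image C f S)"
  note r = eqrel_meet[OF cl[OF equivalence_relation_image[OF f R]] cl[OF equivalence_relation_image[OF f S]]]
  note rel_l = equivalence_relationD(1)[OF equivalence_relation_image[OF f cl[OF M(1)]]]
    and rel_r = equivalence_relationD(1)[OF r(1)]
  have "(f \<cdot> x, f \<cdot> x') \<in> gpairs C Y ?l \<longleftrightarrow> (f \<cdot> x, f \<cdot> x') \<in> gpairs C Y (?cR \<sqinter>\<^bsub>Eq Y\<^esub> ?cS)"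
    if x: "x \<in> Hom C V X" "x' \<in> Hom C V X" for V x x'
    using gpairs_image_iff_join[OF f cl[OF M(1)] x] birkhoff_closure_image[OF birk f R x]
      birkhoff_closure_image[OF birk f S x] key r(2) by simp
  then have "gpairs C Y ?l = gpairs C Y (?cR \<sqinter>\<^bsub>Eq Y\<^esub> ?cS)"
    using gpairs_subset_on_cover[OF f rel_l rel_r] gpairs_subset_on_cover[OF f rel_r rel_l] by blast
  then show ?thesis using subobj_eq_iff_gpairs[OF rel_l rel_r] by simp
qed

lemma birkhoff_whole_category:
  "birkhoff_subcategory C (Obj C) (\<lambda>A. A) (\<lambda>f. f) (Idt C)"
proof (intro birkhoff_subcategory.intro epireflective_subcategory.intro
    epireflective_subcategory_axioms.intro birkhoff_subcategory_axioms.intro)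
  have full: "full_subcategory C (Obj C) = C"
  proof -
    have "{f \<in> Arr C. Dom C f \<in> Obj C \<and> Cod C f \<in> Obj C} = Arr C" using dom_obj cod_obj by blast
    then show ?thesis by (simp add: full_subcategory_def)
  qed
  have "adjunction C C (\<lambda>A. A) (\<lambda>f. f) (\<lambda>A. A) (\<lambda>f. f) (Idt C)"
    by unfold_locales (auto simp: idt_hom comp_idt_left comp_idt_right)
  then show "adjunction C (full_subcategory C (Obj C)) (\<lambda>A. A) (\<lambda>f. f) (\<lambda>A. A) (\<lambda>f. f) (Idt C)"
    by (simp add: full)
next
  show "isomorphism C f \<Longrightarrow> Dom C f \<in> Obj C \<Longrightarrow> Cod C f \<in> Obj C" for f
    using cod_obj by (simp add: isomorphism_def)
  show "regular_epi C f \<Longrightarrow> Dom C f \<in> Obj C \<Longrightarrow> Cod C f \<in> Obj C" for f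
    using cod_obj regular_epi_arr by blast
qed (auto intro: regular_epi_idt category_axioms)

lemma closure_whole_category:
  assumes S: "equivalence_relation C X S"
  shows "equivalence_relation C X (eqrel_closure C (Idt C) X S)"
    "gpairs C X (eqrel_closure C (Idt C) X S) = gpairs C X S"
proof -
  interpret B: birkhoff_subcategory C "Obj C" "\<lambda>A. A" "\<lambda>f. f" "Idt C" by (rule birkhoff_whole_category)
  let ?q = "quotient_map C X S" and ?c = "eqrel_closure C (Idt C) X S"
  define Z where "Z = Cod C ?q"
  note q = quotient_map_props[OF S, folded Z_def]
  note c = closure_props[OF B.epireflective_subcategory_axioms S, folded Z_def]
  show "equivalence_relation C X ?c" by (rule c)
  have "(x, x') \<in> gpairs C X ?c \<longleftrightarrow> (x, x') \<in> gpairs C X S" if x: "x \<in> Hom C T X" "x' \<in> Hom C T X" for T x x'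
    using c(2)[OF x] q(3)[OF x] comp_idt_left[OF comp_hom[OF x(1) q(1)]] comp_idt_left[OF comp_hom[OF x(2) q(1)]]
    by simp
  then show "gpairs C X ?c = gpairs C X S"
    using gpairs_eqI[OF equivalence_relationD(1)[OF c(1)] equivalence_relationD(1)[OF S]] by blast
qed

text \<open>Preservation of meets by the image along the quotient by \<open>T\<close>, pulled back to \<open>X\<close>, is the dual
  distributive law with \<open>T\<close> as the fixed joinand.\<close>

lemma images_preserve_meets_imp_distributive:
  assumes pres: "\<And>Y f R S. \<lbrakk>f \<in> Hom C X Y; regular_epi C f; equivalence_relation C X R; equivalence_relation C X S\<rbrakk>
    \<Longrightarrow> gpairs C Y (rel_image C f R) \<inter> gpairs C Y (rel_image C f S) \<subseteq> gpairs C Y (rel_image C f (R \<sqinter>\<^bsub>Eq X\<^esub> S))"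
  shows "weak_distributive_lattice (Eq X)"
  unfolding weak_distributive_lattice_iff
proof (intro allI impI, elim conjE)
  fix R S T assume R: "equivalence_relation C X R" and S: "equivalence_relation C X S" and T: "equivalence_relation C X T"
  note M = eqrel_meet[OF R S]
  let ?q = "quotient_map C X T"
  define Z where "Z = Cod C ?q"
  note q = quotient_map_props[OF T, folded Z_def]
  note K = kernel_relation_props[OF q(1)]
  have KT: "gpairs C X (kernel_relation C ?q) = gpairs C X T"
    by (rule gpairs_eqI[OF equivalence_relationD(1)[OF K(1)] equivalence_relationD(1)[OF T]])
      (simp add: K(2) q(3))
  have join: "gpairs C X (kernel_relation C ?q \<squnion>\<^bsub>Eq X\<^esub> E) = gpairs C X (T \<squnion>\<^bsub>Eq X\<^esub> E)"
    if E: "equivalence_relation C X E" for E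
    using eqrel_join_mono[OF K(1) E T E] eqrel_join_mono[OF T E K(1) E] KT by blast
  show "gpairs C X (T \<squnion>\<^bsub>Eq X\<^esub> R) \<inter> gpairs C X (T \<squnion>\<^bsub>Eq X\<^esub> S) \<subseteq> gpairs C X (T \<squnion>\<^bsub>Eq X\<^esub> (R \<sqinter>\<^bsub>Eq X\<^esub> S))"
  proof (rule subrelI)
    fix x x' assume xx: "(x, x') \<in> gpairs C X (T \<squnion>\<^bsub>Eq X\<^esub> R) \<inter> gpairs C X (T \<squnion>\<^bsub>Eq X\<^esub> S)"
    then obtain V where x: "x \<in> Hom C V X" "x' \<in> Hom C V X"
      using gpairsE[of x x' X, OF _ equivalence_relationD(1)[OF eqrel_join(1)[OF T R]]] by blast
    have mem: "(?q \<cdot> x, ?q \<cdot> x') \<in> gpairs C Z (rel_image C ?q E) \<longleftrightarrow> (x, x') \<in> gpairs C X (T \<squnion>\<^bsub>Eq X\<^esub> E)"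
      if E: "equivalence_relation C X E" for E
      using gpairs_image_iff_join[OF q(2,1) E x] join[OF E] by simp
    then show "(x, x') \<in> gpairs C X (T \<squnion>\<^bsub>Eq X\<^esub> (R \<sqinter>\<^bsub>Eq X\<^esub> S))"
      using xx pres[OF q(1,2) R S] mem[OF R] mem[OF S] mem[OF M(1)] by blast
  qed
qed

lemma trivial_closure_preserves_meets_imp_distributive:
  assumes pres: "\<And>Y f R S. \<lbrakk>f \<in> Hom C X Y; regular_epi C f; equivalence_relation C X R; equivalence_relation C X S\<rbrakk>
    \<Longrightarrow> subobj_eq C (rel_image C f (eqrel_closure C (Idt C) X (R \<sqinter>\<^bsub>Eq X\<^esub> S)))
      (eqrel_closure C (Idt C) Y (rel_image C f R) \<sqinter>\<^bsub>Eq Y\<^esub> eqrel_closure C (Idt C) Y (rel_image C f S))"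
  shows "weak_distributive_lattice (Eq X)"
proof (rule images_preserve_meets_imp_distributive)
  fix Y f R S assume f: "f \<in> Hom C X Y" "regular_epi C f"
    and R: "equivalence_relation C X R" and S: "equivalence_relation C X S"
  note M = eqrel_meet[OF R S]
  note fR = equivalence_relation_image[OF f(2,1) R] and fS = equivalence_relation_image[OF f(2,1) S]
  note cM = closure_whole_category[OF M(1)]
  note cR = closure_whole_category[OF fR] and cS = closure_whole_category[OF fS]
  note r = eqrel_meet[OF cR(1) cS(1)]
  have rel: "relation_on C Y (rel_image C f (eqrel_closure C (Idt C) X (R \<sqinter>\<^bsub>Eq X\<^esub> S)))"
    using gpairs_rel_image(1)[OF f(1) equivalence_relationD(1)[OF cM(1)]] .
  have "gpairs C Y (rel_image C f (eqrel_closure C (Idt C) X (R \<sqinter>\<^bsub>Eq X\<^esub> S))) =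
      gpairs C Y (rel_image C f R) \<inter> gpairs C Y (rel_image C f S)"
    using pres[OF f R S] subobj_eq_iff_gpairs[OF rel equivalence_relationD(1)[OF r(1)]] r(2) cR(2) cS(2) by simp
  moreover have "gpairs C Y (rel_image C f (eqrel_closure C (Idt C) X (R \<sqinter>\<^bsub>Eq X\<^esub> S))) \<subseteq>
      gpairs C Y (rel_image C f (R \<sqinter>\<^bsub>Eq X\<^esub> S))"
  proof (rule subrelI)
    fix y y' assume yy: "(y, y') \<in> gpairs C Y (rel_image C f (eqrel_closure C (Idt C) X (R \<sqinter>\<^bsub>Eq X\<^esub> S)))"
    obtain T where y: "y \<in> Hom C T Y" "y' \<in> Hom C T Y" using gpairsE[OF yy rel] by blast
    show "(y, y') \<in> gpairs C Y (rel_image C f (R \<sqinter>\<^bsub>Eq X\<^esub> S))"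
      using yy unfolding gpairs_rel_image(2)[OF f(1) equivalence_relationD(1)[OF cM(1)] y]
        gpairs_rel_image(2)[OF f(1) equivalence_relationD(1)[OF M(1)] y] cM(2) .
  qed
  ultimately show "gpairs C Y (rel_image C f R) \<inter> gpairs C Y (rel_image C f S) \<subseteq>
      gpairs C Y (rel_image C f (R \<sqinter>\<^bsub>Eq X\<^esub> S))" by blast
qed

end

theorem proposition3p13:
  fixes C :: "('o, 'a) category"
  assumes "exact_goursat_category C"
  shows "(\<forall>X \<in> Obj C. weak_distributive_lattice (eqrel_lattice C X)) \<longleftrightarrow>
    (\<forall>L Lo La \<eta>. birkhoff_subcategory C L Lo La \<eta> \<longrightarrow>
      (\<forall>X Y f R S. f \<in> Hom C X Y \<and> regular_epi C f \<and>
          equivalence_relation C X R \<and> equivalence_relation C X S \<longrightarrow>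
        subobj_eq C
          (rel_image C f (eqrel_closure C \<eta> X (R \<sqinter>\<^bsub>eqrel_lattice C X\<^esub> S)))
          (eqrel_closure C \<eta> Y (rel_image C f R) \<sqinter>\<^bsub>eqrel_lattice C Y\<^esub> eqrel_closure C \<eta> Y (rel_image C f S))))"
proof -
  interpret exact_goursat_category C by (rule assms)
  show ?thesis
  proof (intro iffI allI impI ballI)
    fix L Lo La \<eta> X Y f R S
    assume "\<forall>X \<in> Obj C. weak_distributive_lattice (eqrel_lattice C X)" "birkhoff_subcategory C L Lo La \<eta>"
      and "f \<in> Hom C X Y \<and> regular_epi C f \<and> equivalence_relation C X R \<and> equivalence_relation C X S"
    then show "subobj_eq C
          (rel_image C f (eqrel_closure C \<eta> X (R \<sqinter>\<^bsub>eqrel_lattice C X\<^esub> S)))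
          (eqrel_closure C \<eta> Y (rel_image C f R) \<sqinter>\<^bsub>eqrel_lattice C Y\<^esub> eqrel_closure C \<eta> Y (rel_image C f S))"
      using distributive_imp_closure_preserves_meets[of X L Lo La \<eta> f Y R S] HomD(4)[of f X Y] by blast
  next
    fix X
    assume pres: "\<forall>L Lo La \<eta>. birkhoff_subcategory C L Lo La \<eta> \<longrightarrow>
      (\<forall>X Y f R S. f \<in> Hom C X Y \<and> regular_epi C f \<and>
          equivalence_relation C X R \<and> equivalence_relation C X S \<longrightarrow>
        subobj_eq C
          (rel_image C f (eqrel_closure C \<eta> X (R \<sqinter>\<^bsub>eqrel_lattice C X\<^esub> S)))
          (eqrel_closure C \<eta> Y (rel_image C f R) \<sqinter>\<^bsub>eqrel_lattice C Y\<^esub> eqrel_closure C \<eta> Y (rel_image C f S)))"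
    show "weak_distributive_lattice (eqrel_lattice C X)"
      using pres[rule_format, OF birkhoff_whole_category]
      by (intro trivial_closure_preserves_meets_imp_distributive) blast
  qed
qed

end
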